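(* Let $\eta$ be a composition of $n$ with positive parts and $\gamma\in Y_\eta$. Then $\sum_{m\ge0}K_{\Phi(\eta)}(m\gamma\mid q)\,t^m=P_{\eta\gamma}(q,t)/Q_{\eta\gamma}(q,t)$, where $P_{\eta\gamma}$ and $Q_{\eta\gamma}$ are mutually prime polynomials in $q$ and $t$ with integer coefficients and $P_{\eta\gamma}(0,0)=1$. Moreover: (a) $Q_{\eta\gamma}(q,t)=\prod_{j\in J}(1-q^jt)$ for a finite multiset $J=J_{\eta\gamma}$ of non-negative integers; (b) $P_{\eta\gamma}(1,t)=(1-t)^{t(\eta,\gamma)}P_{\eta\gamma}(t)$ with $t(\eta,\gamma)\in\mathbb{Z}_{\ge0}$, $P_{\eta\gamma}(1)\ne0$, and $P_{\eta\gamma}(t)$ a polynomial with non-negative integer coefficients.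
   Context: For $\eta=(\eta_1,\dots,\eta_p)$, $r_k=\eta_1+\cdots+\eta_k$, $r_0=0$; $\Phi(\eta)=\{(i,j):1\le i\le r_k<j\le n\text{ for some }k\}$; for $\gamma\in\mathbb{Z}^n$ with $\sum\gamma_i=0$, $K_{\Phi(\eta)}(\gamma\mid q)$ is the coefficient of $x^\gamma$ in $\prod_{(i,j)\in\Phi(\eta)}(1-qx_i/x_j)^{-1}$ expanded as geometric series in $x_i/x_j$. $Y_\eta$ is the set of $\gamma\in\mathbb{Z}^n$ with $\sum\gamma_i=0$ such that for each $0\le k\le p-1$ and every $\Omega_k\subseteq\{r_k+1,\dots,r_{k+1}\}$, $\sum_{j\le r_k}\gamma_j+\sum_{a\in\Omega_k}\gamma_a\ge0$. *)

theory Defs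
  imports "HOL-Library.Poly_Mapping" "HOL-Library.Multiset"
    "HOL-Computational_Algebra.Computational_Algebra"
begin

text \<open>
  A composition is a list of naturals (its parts). Vectors in the lattice of rank \<open>n\<close> are finitely
  supported functions \<open>\<gamma> :: nat \<Rightarrow>\<^sub>0 int\<close> with support in \<open>{1..n}\<close>, so the coordinates are numbered
  from 1.
\<close>

definition psum :: "nat list \<Rightarrow> nat \<Rightarrow> nat" where
  "psum \<eta> k = sum_list (take k \<eta>)"

definition Phi :: "nat list \<Rightarrow> (nat \<times> nat) set" where
  "Phi \<eta> = {(i, j). \<exists>k \<le> length \<eta>. 1 \<le> i \<and> i \<le> psum \<eta> k \<and> psum \<eta> k < j \<and> j \<le> sum_list \<eta>}"

lemma finite_Phi: "finite (Phi \<eta>)"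
proof (rule finite_subset)
  have "psum \<eta> k \<le> sum_list \<eta>" for k
    unfolding psum_def by (metis append_take_drop_id le_add1 sum_list_append)
  then show "Phi \<eta> \<subseteq> {..sum_list \<eta>} \<times> {..sum_list \<eta>}"
    unfolding Phi_def by (auto intro: order_trans)
qed simp

definition Y :: "nat list \<Rightarrow> (nat \<Rightarrow>\<^sub>0 int) set" where
  "Y \<eta> = {\<gamma>. Poly_Mapping.keys \<gamma> \<subseteq> {1..sum_list \<eta>}
          \<and> (\<Sum>i = 1..sum_list \<eta>. Poly_Mapping.lookup \<gamma> i) = 0
          \<and> (\<forall>k < length \<eta>. \<forall>\<Omega> \<subseteq> {psum \<eta> k + 1..psum \<eta> (k + 1)}.
               (\<Sum>j = 1..psum \<eta> k. Poly_Mapping.lookup \<gamma> j) + (\<Sum>a\<in>\<Omega>. Poly_Mapping.lookup \<gamma> a) \<ge> 0)}"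

text \<open>
  Integer Laurent polynomials in the variables \<open>x\<^sub>i\<close> are the group ring
  \<open>(nat \<Rightarrow>\<^sub>0 int) \<Rightarrow>\<^sub>0 int\<close>, where \<open>single \<alpha> c\<close> stands for \<open>c\<close> times the monomial \<open>x\<close> to the \<open>\<alpha>\<close>.
\<close>

definition xratio :: "nat \<Rightarrow> nat \<Rightarrow> ((nat \<Rightarrow>\<^sub>0 int) \<Rightarrow>\<^sub>0 int)" where
  "xratio i j = Poly_Mapping.single (Poly_Mapping.single i 1 - Poly_Mapping.single j 1) 1"

text \<open>
  The expansion of \<open>1 / (1 - q x\<^sub>i / x\<^sub>j)\<close>, as a formal power series in \<open>q\<close> (the variable of the type
  \<open>fps\<close>) over the Laurent polynomials. The type \<open>fps\<close> has no inverse over this coefficient ring,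
  hence the explicit series; lemma \<open>geom_inverse\<close> shows that it is the inverse.
\<close>

definition geom :: "nat \<Rightarrow> nat \<Rightarrow> ((nat \<Rightarrow>\<^sub>0 int) \<Rightarrow>\<^sub>0 int) fps" where
  "geom i j = Abs_fps (\<lambda>m. xratio i j ^ m)"

lemma geom_inverse: "(1 - fps_X * fps_const (xratio i j)) * geom i j = 1"
proof (rule fps_ext)
  fix m
  have "(1 - fps_X * fps_const (xratio i j)) * geom i j
      = geom i j - fps_X * (fps_const (xratio i j) * geom i j)"
    by (simp add: algebra_simps)
  then show "fps_nth ((1 - fps_X * fps_const (xratio i j)) * geom i j) m = fps_nth 1 m"
    by (cases m) (simp_all add: geom_def)
qed

text \<open>
  The coefficient of the monomial with exponent \<open>\<gamma>\<close>, extracted from each power of \<open>q\<close>. It is a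
  polynomial in \<open>q\<close>, here given as a formal power series in \<open>q\<close>.
\<close>

definition K :: "nat list \<Rightarrow> (nat \<Rightarrow>\<^sub>0 int) \<Rightarrow> int fps" where
  "K \<eta> \<gamma> = Abs_fps (\<lambda>d. Poly_Mapping.lookup (fps_nth (\<Prod>(i, j)\<in>Phi \<eta>. geom i j) d) \<gamma>)"

definition scale :: "nat \<Rightarrow> (nat \<Rightarrow>\<^sub>0 int) \<Rightarrow> (nat \<Rightarrow>\<^sub>0 int)" where
  "scale m \<gamma> = Poly_Mapping.map (\<lambda>c. int m * c) \<gamma>"

lemma lookup_scale: "Poly_Mapping.lookup (scale m \<gamma>) i = int m * Poly_Mapping.lookup \<gamma> i"
  by (simp add: scale_def Poly_Mapping.map.rep_eq when_def)

text \<open>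
  Polynomials in \<open>q\<close> and \<open>t\<close> have type \<open>int poly poly\<close>, power series type \<open>int fps fps\<close>; in both, the
  outer variable is \<open>t\<close> and the inner one is \<open>q\<close>.
\<close>

definition fps2_of_poly2 :: "int poly poly \<Rightarrow> int fps fps" where
  "fps2_of_poly2 P = fps_of_poly (map_poly fps_of_poly P)"

definition eval_q1 :: "int poly poly \<Rightarrow> int poly" where
  "eval_q1 P = map_poly (\<lambda>c. poly c 1) P"

end

theory Submission
  imports Defs "HOL-Analysis.Continuum_Not_Denumerable"
begin

text \<open>
  The coefficient of \<open>q^d\<close> in \<open>K(m\<gamma>)\<close> counts the flows \<open>f\<close> on the edge set \<open>\<Phi>(\<eta>)\<close> with net
  flow \<open>m\<gamma>\<close> and total \<open>d\<close>, that is, the lattice points \<open>(m, f)\<close> of a cone. By integrality of flows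
  each nonzero point of the cone contains in its support an integral flow of degree \<open>m = 1\<close>.
  Pulling successively at such flows triangulates the cone into simplicial cones generated in
  degree 1, all of the same dimension \<open>r\<close>; a generic perturbation decides to which cell a common
  boundary point belongs and so makes the cells half-open and disjoint. A cell with generators
  \<open>b\<close> contributes \<open>N / \<Prod>\<^sub>b (1 - q^|b| t)\<close>, where \<open>N\<close> counts the lattice points of the half-open
  fundamental parallelepiped. The sum of these fractions has a denominator of the required form,
  which remains so after cancellation because its factors are irreducible. At \<open>q = 1\<close> all cells have
  the denominator \<open>(1 - t)^r\<close>, so the numerator is a power of \<open>1 - t\<close> times a polynomial with
  nonnegative coefficients.
\<close>

section \<open>Integrality of flows\<close>

text \<open>Closed cells overlap, and correcting this by inclusion and exclusion would bring in
  signs that ruin the nonnegativity in (b); hence the insistence on disjoint cells. The perturbation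
  \<open>y\<close> has to stay generic in every face reached by repeated pulling, and these faces
  are found only during the recursion. As every projection involved is rational, it is enough that
  \<open>y\<close> lies on no rational hyperplane other than those containing the whole face. A
  combination of generators whose weights are distinct powers of a transcendental number has this
  property. The weights are also positive, so \<open>y\<close> is nonnegative and the cells cover
  the whole cone at the top level. Nonnegativity controls the cancellation as well: a nonzero
  polynomial with nonnegative coefficients does not vanish at t = 1, so the factors 1 - t lost by
  cancelling can only come out of the explicit power of 1 - t. The value P(0,0) = 1 reflects
  acyclicity: edges increase the index, so the zero flow is the only one with net flow 0.\<close>

lemma homogeneous_system:
  fixes a :: "'i \<Rightarrow> 'e \<Rightarrow> real"
  assumes "finite I" "finite F" "card I < card F"
  shows "\<exists>d. (\<exists>e\<in>F. d e \<noteq> 0) \<and> (\<forall>i\<in>I. (\<Sum>e\<in>F. a i e * d e) = 0)"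
  using assms
proof (induction I arbitrary: F a rule: finite_induct)
  case empty
  then obtain e where "e \<in> F" by (metis card.empty card_gt_0_iff ex_in_conv)
  then show ?case by (intro exI[of _ "\<lambda>_. 1"]) auto
next
  case (insert i I)
  show ?case
  proof (cases "\<forall>e\<in>F. a i e = 0")
    case True
    have "card I < card F" using insert.hyps insert.prems(2) by auto
    from insert.IH[OF insert.prems(1) this, of a] show ?thesis using True by auto
  next
    case False
    then obtain f where f: "f \<in> F" "a i f \<noteq> 0" by blast
    have "card I < card (F - {f})" using insert f by (simp add: card_Diff_singleton)
    \<comment> \<open>Gaussian elimination: equation \<open>i\<close> is solved for the unknown at
      \<open>f\<close> and substituted into the other equations; \<open>s\<close> below is the
      resulting value at \<open>f\<close>.\<close>
    with insert.IH[of "F - {f}" "\<lambda>k e. a k e - a k f * a i e / a i f"] insert.prems(1)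
    obtain d where d: "\<exists>e\<in>F - {f}. d e \<noteq> 0"
      "\<forall>k\<in>I. (\<Sum>e\<in>F - {f}. (a k e - a k f * a i e / a i f) * d e) = 0" by auto
    define s where "s = - (\<Sum>e\<in>F - {f}. a i e * d e) / a i f"
    have split: "(\<Sum>e\<in>F. a k e * (d(f := s)) e) = a k f * s + (\<Sum>e\<in>F - {f}. a k e * d e)" for k
      using insert.prems(1) f by (subst sum.remove[of _ f]) auto
    have "(\<Sum>e\<in>F. a k e * (d(f := s)) e) = 0" if "k \<in> I" for k
    proof -
      have "0 = (\<Sum>e\<in>F - {f}. a k e * d e - a k f / a i f * (a i e * d e))"
        using d(2) that by (auto simp: algebra_simps intro!: sum.cong)
      also have "\<dots> = (\<Sum>e\<in>F - {f}. a k e * d e) - a k f / a i f * (\<Sum>e\<in>F - {f}. a i e * d e)"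
        by (simp only: sum_subtractf sum_distrib_left)
      also have "\<dots> = (\<Sum>e\<in>F - {f}. a k e * d e) + a k f * s"
        by (simp add: s_def)
      finally show ?thesis using split[of k] by simp
    qed
    moreover have "(\<Sum>e\<in>F. a i e * (d(f := s)) e) = 0"
      using split[of i] f by (simp add: s_def)
    moreover have "\<exists>e\<in>F. (d(f := s)) e \<noteq> 0" using d(1) by auto
    ultimately show ?thesis by (intro exI[of _ "d(f := s)"]) auto
  qed
qed

lemma card_filter_eq_sum: "finite A \<Longrightarrow> card {x \<in> A. P x} = (\<Sum>x\<in>A. if P x then 1 else 0)"
  by (subst sum.inter_filter[symmetric]) auto

text \<open>The signed incidence matrix, with the sign that makes the net flow at \<open>i\<close>
  the exponent of the i-th variable when edge \<open>e\<close> contributes the ratio of its two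
  variables to the power \<open>f e\<close>.\<close>

definition inc :: "nat \<times> nat \<Rightarrow> nat \<Rightarrow> int" where
  "inc e i = of_bool (fst e = i) - of_bool (snd e = i)"

(* Every vertex touched by F meets at least two edges of F, so there are at most as many vertices
   as edges; since the conservation equations add up to zero, one of them is redundant. *)
lemma circulation_on_fractional_edges:
  fixes f :: "nat \<times> nat \<Rightarrow> real"
  assumes fin: "finite F" and ne: "F \<noteq> {}" and loop: "\<And>e. e \<in> F \<Longrightarrow> fst e \<noteq> snd e"
    and frac: "\<And>e. e \<in> F \<Longrightarrow> f e \<notin> \<int>"
    and net: "\<And>i. (\<Sum>e\<in>F. real_of_int (inc e i) * f e) \<in> \<int>"
  shows "\<exists>d. (\<exists>e\<in>F. d e \<noteq> 0) \<and> (\<forall>i. (\<Sum>e\<in>F. real_of_int (inc e i) * d e) = 0)"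
proof -
  define W where "W = fst ` F \<union> snd ` F"
  have finW: "finite W" using fin by (simp add: W_def)
  \<comment> \<open>A single fractional edge at \<open>w\<close> would be the only term there, so
    the net flow would be plus or minus a non-integer.\<close>
  have deg: "2 \<le> card {e \<in> F. fst e = w \<or> snd e = w}" if w: "w \<in> W" for w
  proof (rule ccontr)
    let ?D = "{e \<in> F. fst e = w \<or> snd e = w}"
    assume "\<not> 2 \<le> card ?D"
    moreover obtain e where "e \<in> F" "fst e = w \<or> snd e = w" using w by (auto simp: W_def)
    then have "?D \<noteq> {}" by blast
    then have "card ?D \<noteq> 0" using fin by simp
    ultimately have "card ?D = 1" by linarith
    then obtain e where e: "?D = {e}" by (rule card_1_singletonE)
    then have eF: "e \<in> F" "fst e = w \<or> snd e = w" by auto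
    have "(\<Sum>e\<in>F. real_of_int (inc e w) * f e) = (\<Sum>e\<in>?D. real_of_int (inc e w) * f e)"
      by (rule sum.mono_neutral_right) (use fin in \<open>auto simp: inc_def\<close>)
    then have "real_of_int (inc e w) * f e \<in> \<int>" using net[of w] by (simp add: e)
    then have "f e \<in> \<int>" using eF loop[OF eF(1)] by (auto simp: inc_def)
    then show False using frac eF by blast
  qed
  have "2 * card W \<le> (\<Sum>w\<in>W. card {e \<in> F. fst e = w \<or> snd e = w})"
    using sum_bounded_below[of W 2 "\<lambda>w. card {e \<in> F. fst e = w \<or> snd e = w}"] deg by simp
  also have "\<dots> = (\<Sum>w\<in>W. \<Sum>e\<in>F. (if fst e = w \<or> snd e = w then 1 else 0))"
    using fin by (simp add: card_filter_eq_sum)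
  also have "\<dots> = (\<Sum>e\<in>F. \<Sum>w\<in>W. (if fst e = w \<or> snd e = w then 1 else 0))"
    by (rule sum.swap)
  also have "\<dots> = (\<Sum>e\<in>F. 2)"
  proof (rule sum.cong[OF refl])
    fix e assume e: "e \<in> F"
    have "(\<Sum>w\<in>W. (if fst e = w \<or> snd e = w then 1 else 0)) = card {w \<in> W. fst e = w \<or> snd e = w}"
      using finW by (simp add: card_filter_eq_sum)
    also have "{w \<in> W. fst e = w \<or> snd e = w} = {fst e, snd e}" using e by (auto simp: W_def)
    finally show "(\<Sum>w\<in>W. (if fst e = w \<or> snd e = w then 1 else 0)) = (2::nat)" using loop[OF e] by simp
  qed
  finally have card: "card W \<le> card F" by simp
  obtain w where w: "w \<in> W" using ne by (auto simp: W_def)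
  have "card (W - {w}) < card F" using card w finW by (metis card_Diff1_less less_le_trans)
  from homogeneous_system[OF _ fin this, of "\<lambda>i e. real_of_int (inc e i)"] finW
  obtain d where d: "\<exists>e\<in>F. d e \<noteq> 0"
    "\<And>i. i \<in> W - {w} \<Longrightarrow> (\<Sum>e\<in>F. real_of_int (inc e i) * d e) = 0" by auto
  have tot: "(\<Sum>i\<in>W. real_of_int (inc e i)) = 0" if "e \<in> F" for e
  proof -
    have "fst e \<in> W" "snd e \<in> W" using that by (auto simp: W_def)
    moreover have "real_of_int (inc e i) = (if fst e = i then 1 else 0) - (if snd e = i then 1 else 0)" for i
      by (simp add: inc_def)
    ultimately show ?thesis using finW by (simp add: sum_subtractf)
  qed
  have "(\<Sum>i\<in>W. \<Sum>e\<in>F. real_of_int (inc e i) * d e)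
      = (\<Sum>e\<in>F. (\<Sum>i\<in>W. real_of_int (inc e i)) * d e)"
    by (subst sum.swap) (simp add: sum_distrib_right)
  also have "\<dots> = 0" using tot by simp
  finally have "(\<Sum>e\<in>F. real_of_int (inc e w) * d e) = 0"
    using d(2) by (simp add: sum.remove[OF finW w])
  moreover have "(\<Sum>e\<in>F. real_of_int (inc e i) * d e) = 0" if "i \<notin> W" for i
    using that by (intro sum.neutral) (force simp: inc_def W_def)
  ultimately show ?thesis using d by blast
qed

text \<open>Adding a multiple of a circulation on the fractional edges keeps the net flow. It is
  increased until some edge first becomes integral; no edge has passed below its floor by then, and
  integral edges, in particular empty ones, do not move. So the number of fractional edges drops
  while nonnegativity and the bound on the support persist.\<close>

lemma flow_rounding:
  fixes f :: "nat \<times> nat \<Rightarrow> real"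
  assumes fin: "finite A" and loop: "\<And>e. e \<in> A \<Longrightarrow> fst e \<noteq> snd e"
    and nonneg: "\<And>e. e \<in> A \<Longrightarrow> 0 \<le> f e"
    and net: "\<And>i. (\<Sum>e\<in>A. real_of_int (inc e i) * f e) \<in> \<int>"
  shows "\<exists>g :: nat \<times> nat \<Rightarrow> nat. (\<forall>e. g e \<noteq> 0 \<longrightarrow> e \<in> A \<and> f e \<noteq> 0) \<and>
    (\<forall>i. (\<Sum>e\<in>A. real_of_int (inc e i) * real (g e)) = (\<Sum>e\<in>A. real_of_int (inc e i) * f e))"
  using nonneg net
proof (induction "card {e \<in> A. f e \<notin> \<int>}" arbitrary: f rule: less_induct)
  case less
  define F where "F = {e \<in> A. f e \<notin> \<int>}"
  have finF: "finite F" "F \<subseteq> A" using fin by (auto simp: F_def)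
  show ?case
  proof (cases "F = {}")
    case True
    then have int: "f e \<in> \<int>" if "e \<in> A" for e using that unfolding F_def by blast
    define g where "g e = (if e \<in> A then nat \<lfloor>f e\<rfloor> else 0)" for e
    have "real (g e) = f e" if "e \<in> A" for e
      using int[OF that] less.prems(1)[OF that] that by (auto simp: g_def elim!: Ints_cases)
    then show ?thesis
      by (intro exI[of _ g]) (auto simp: g_def intro!: sum.cong)
  next
    case False
    have "(\<Sum>e\<in>F. real_of_int (inc e i) * f e) \<in> \<int>" for i
    proof -
      have "(\<Sum>e\<in>F. real_of_int (inc e i) * f e)
          = (\<Sum>e\<in>A. real_of_int (inc e i) * f e) - (\<Sum>e\<in>A - F. real_of_int (inc e i) * f e)"
        using fin finF by (simp add: sum_diff)
      also have "\<dots> \<in> \<int>"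
        by (intro Ints_diff less.prems(2) Ints_sum Ints_mult) (auto simp: F_def)
      finally show ?thesis .
    qed
    then have "\<exists>d. (\<exists>e\<in>F. d e \<noteq> 0) \<and> (\<forall>i. (\<Sum>e\<in>F. real_of_int (inc e i) * d e) = 0)"
      using finF loop by (intro circulation_on_fractional_edges[of _ f] False) (auto simp only: F_def)
    then obtain d0 where d0: "\<exists>e\<in>F. d0 e \<noteq> 0" "\<And>i. (\<Sum>e\<in>F. real_of_int (inc e i) * d0 e) = 0"
      by blast
    define d where "d e = (if e \<in> F then d0 e else 0)" for e
    have dsum: "(\<Sum>e\<in>A. real_of_int (inc e i) * d e) = 0" for i
    proof -
      have "(\<Sum>e\<in>A. real_of_int (inc e i) * d e) = (\<Sum>e\<in>F. real_of_int (inc e i) * d0 e)"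
        using fin finF by (intro sum.mono_neutral_cong_right) (auto simp: d_def)
      then show ?thesis using d0 by simp
    qed
    define D where "D = {e \<in> F. d e \<noteq> 0}"
    \<comment> \<open>The time at which edge \<open>e\<close>, moving at speed \<open>d e\<close>,
      meets the next integer in its direction.\<close>
    define \<tau> where "\<tau> e = ((if 0 < d e then of_int \<lceil>f e\<rceil> else of_int \<lfloor>f e\<rfloor>) - f e) / d e" for e
    have D: "finite D" "D \<noteq> {}" using finF d0(1) by (auto simp: D_def d_def)
    define e0 where "e0 = arg_min_on \<tau> D"
    have e0: "e0 \<in> D" "\<And>e. e \<in> D \<Longrightarrow> \<tau> e0 \<le> \<tau> e"
      using arg_min_if_finite[OF D, of \<tau>] by (auto simp: e0_def not_less)
    have fl: "of_int \<lfloor>f e\<rfloor> < f e" "f e < of_int \<lceil>f e\<rceil>" if "e \<in> F" for e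
    proof -
      have "f e \<noteq> of_int z" for z using that Ints_of_int[of z] by (auto simp: F_def simp del: Ints_of_int)
      then show "of_int \<lfloor>f e\<rfloor> < f e" "f e < of_int \<lceil>f e\<rceil>"
        by (metis less_le of_int_floor_le, metis less_le le_of_int_ceiling)
    qed
    have pos: "0 < \<tau> e0" using e0(1) fl[of e0]
      by (auto simp: \<tau>_def D_def divide_simps)
    define f' where "f' e = f e + \<tau> e0 * d e" for e
    have lower: "of_int \<lfloor>f e\<rfloor> \<le> f' e" for e
    proof (cases "e \<in> D \<and> d e < 0")
      case True
      then have "\<tau> e0 * d e \<ge> \<tau> e * d e" using e0(2) by (simp add: mult_right_mono_neg)
      then show ?thesis using True by (simp add: f'_def \<tau>_def)
    next
      case False
      then have "0 \<le> d e" by (auto simp: D_def d_def not_less)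
      then have "f e \<le> f' e" using pos by (simp add: f'_def)
      then show ?thesis by (meson of_int_floor_le order_trans)
    qed
    have nonneg': "0 \<le> f' e" if "e \<in> A" for e
      using lower[of e] less.prems(1)[OF that] by (smt (verit) of_int_0_le_iff zero_le_floor)
    have net': "(\<Sum>e\<in>A. real_of_int (inc e i) * f' e) = (\<Sum>e\<in>A. real_of_int (inc e i) * f e)" for i
    proof -
      have "(\<Sum>e\<in>A. real_of_int (inc e i) * f' e)
        = (\<Sum>e\<in>A. real_of_int (inc e i) * f e) + \<tau> e0 * (\<Sum>e\<in>A. real_of_int (inc e i) * d e)"
        by (simp add: f'_def algebra_simps sum.distrib sum_distrib_left)
      then show ?thesis by (simp add: dsum)
    qed
    have "f' e0 \<in> \<int>" using e0(1) by (simp add: f'_def \<tau>_def D_def)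
    moreover have "f' e = f e" if "e \<notin> F" for e using that by (simp add: f'_def d_def)
    moreover have "e0 \<in> F" using e0(1) by (simp add: D_def)
    ultimately have "{e \<in> A. f' e \<notin> \<int>} \<subset> F" by (auto simp: F_def)
    then have "card {e \<in> A. f' e \<notin> \<int>} < card {e \<in> A. f e \<notin> \<int>}"
      using finF by (simp add: F_def psubset_card_mono)
    from less.hyps[OF this] nonneg' net' less.prems(2)
    obtain g :: "nat \<times> nat \<Rightarrow> nat" where g: "\<And>e. g e \<noteq> 0 \<Longrightarrow> e \<in> A \<and> f' e \<noteq> 0"
      "\<And>i. (\<Sum>e\<in>A. real_of_int (inc e i) * real (g e)) = (\<Sum>e\<in>A. real_of_int (inc e i) * f' e)"
      by auto
    have "f' e = 0" if "f e = 0" for e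
    proof -
      have "e \<notin> F" using that by (auto simp: F_def)
      then show ?thesis using that by (simp add: f'_def d_def)
    qed
    then show ?thesis using g net' by (intro exI[of _ g]) auto
  qed
qed

section \<open>Half-open triangulations by pulling\<close>

definition lincomb :: "('e \<Rightarrow> nat) set \<Rightarrow> (('e \<Rightarrow> nat) \<Rightarrow> real) \<Rightarrow> 'e \<Rightarrow> real" where
  "lincomb B c e = (\<Sum>b\<in>B. c b * real (b e))"

definition basis_of :: "('e \<Rightarrow> nat) set \<Rightarrow> ('e \<Rightarrow> real) set \<Rightarrow> bool" where
  "basis_of B U \<longleftrightarrow> finite B \<and> (\<forall>x. x \<in> U \<longleftrightarrow> (\<exists>c. x = lincomb B c)) \<and>
    (\<forall>c. lincomb B c = (\<lambda>_. 0) \<longrightarrow> (\<forall>b\<in>B. c b = 0))"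

(* A cell is a pair (B, T): the generators in B, and those T among them whose coefficient must not
   vanish. *)
definition half_open_cone :: "('e \<Rightarrow> nat) set \<times> ('e \<Rightarrow> nat) set \<Rightarrow> ('e \<Rightarrow> real) set" where
  "half_open_cone p = {lincomb (fst p) c | c. \<forall>b\<in>fst p. 0 \<le> c b \<and> (b \<in> snd p \<longrightarrow> 0 < c b)}"

lemma lincomb_insert:
  assumes "finite B" "b \<notin> B"
  shows "lincomb (insert b B) c = (\<lambda>e. c b * real (b e) + lincomb B c e)"
  using assms by (auto simp: lincomb_def)

lemma lincomb_cong: "(\<And>b. b \<in> B \<Longrightarrow> c b = c' b) \<Longrightarrow> lincomb B c = lincomb B c'"
  by (auto simp: lincomb_def intro!: ext sum.cong)

lemma lincomb_single:
  assumes "finite B" "b \<in> B"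
  shows "lincomb B (\<lambda>b'. of_bool (b' = b)) = (\<lambda>e. real (b e))"
proof
  fix e
  have "lincomb B (\<lambda>b'. of_bool (b' = b)) e = (\<Sum>b'\<in>B. if b' = b then real (b' e) else 0)"
    unfolding lincomb_def by (rule sum.cong) auto
  then show "lincomb B (\<lambda>b'. of_bool (b' = b)) e = real (b e)" using assms by simp
qed

lemma basis_mem:
  assumes "basis_of B U" "b \<in> B"
  shows "(\<lambda>e. real (b e)) \<in> U"
  using assms lincomb_single[of B b] unfolding basis_of_def by metis

lemma basis_coeffs_unique:
  assumes "basis_of B U" "lincomb B c = lincomb B c'" "b \<in> B"
  shows "c b = c' b"
proof -
  have "lincomb B (\<lambda>b. c b - c' b) = (\<lambda>_. 0)"
    using assms(2) by (auto simp: fun_eq_iff lincomb_def left_diff_distrib sum_subtractf)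
  then have "c b - c' b = 0" using assms(1,3) unfolding basis_of_def by metis
  then show ?thesis by simp
qed

text \<open>The coordinates of \<open>B'\<close> with respect to \<open>B\<close> form a homogeneous
  system; if it had fewer equations than unknowns, a nontrivial solution would be a linear
  dependence in \<open>B'\<close>.\<close>

lemma basis_card_le:
  assumes B: "basis_of B U" and B': "basis_of B' U"
  shows "card B' \<le> card B"
proof (rule ccontr)
  assume "\<not> ?thesis"
  then have lt: "card B < card B'" by simp
  have fin: "finite B" "finite B'" using B B' by (auto simp: basis_of_def)
  have "\<exists>c. (\<lambda>e. real (b e)) = lincomb B c" if "b \<in> B'" for b
    using basis_mem[OF B' that] B by (simp add: basis_of_def)
  then obtain c where c: "\<And>b. b \<in> B' \<Longrightarrow> (\<lambda>e. real (b e)) = lincomb B (c b)" by metis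
  from homogeneous_system[OF fin lt, of "\<lambda>b b'. c b' b"]
  obtain d where d: "\<exists>b\<in>B'. d b \<noteq> 0" "\<And>b. b \<in> B \<Longrightarrow> (\<Sum>b'\<in>B'. c b' b * d b') = 0" by auto
  have "lincomb B' d e = 0" for e
  proof -
    have "lincomb B' d e = (\<Sum>b'\<in>B'. d b' * (\<Sum>b\<in>B. c b' b * real (b e)))"
      unfolding lincomb_def
      by (rule sum.cong) (use c in \<open>auto simp: fun_eq_iff lincomb_def\<close>)
    also have "\<dots> = (\<Sum>b'\<in>B'. \<Sum>b\<in>B. (c b' b * d b') * real (b e))"
      by (simp add: sum_distrib_left mult_ac)
    also have "\<dots> = (\<Sum>b\<in>B. (\<Sum>b'\<in>B'. c b' b * d b') * real (b e))"
      by (subst sum.swap) (simp add: sum_distrib_right)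
    also have "\<dots> = 0" using d(2) by simp
    finally show ?thesis .
  qed
  then have "lincomb B' d = (\<lambda>_. 0)" by auto
  then show False using d(1) B' unfolding basis_of_def by blast
qed

lemma basis_card_eq: "basis_of B U \<Longrightarrow> basis_of B' U \<Longrightarrow> card B = card B'"
  by (meson basis_card_le le_antisym)

(* This says that x + \<epsilon> y \<ge> 0 for all sufficiently small \<epsilon> > 0. *)
definition lex_nonneg :: "('e \<Rightarrow> real) \<Rightarrow> ('e \<Rightarrow> real) \<Rightarrow> bool" where
  "lex_nonneg x y \<longleftrightarrow> (\<forall>e. 0 < x e \<or> x e = 0 \<and> 0 \<le> y e)"

text \<open>For \<open>g e\<close> nonzero, the projection along \<open>g\<close> onto the
  hyperplane where coordinate \<open>e\<close> vanishes.\<close>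

definition proj :: "('e \<Rightarrow> nat) \<Rightarrow> 'e \<Rightarrow> ('e \<Rightarrow> real) \<Rightarrow> 'e \<Rightarrow> real" where
  "proj g e x = (\<lambda>e'. x e' - x e / real (g e) * real (g e'))"

text \<open>The cone to be triangulated is the set of nonnegative vectors of \<open>V\<close>. The
  axiom \<open>generator\<close> is the abstract form of integrality: every nonzero face of this
  cone contains a nonzero generator at which it can be pulled.\<close>

locale pulling =
  fixes E :: "'e set" and V :: "('e \<Rightarrow> real) set" and G :: "('e \<Rightarrow> nat) set"
  assumes finite_E: "finite E"
    and V_supp: "x \<in> V \<Longrightarrow> e \<notin> E \<Longrightarrow> x e = 0"
    and V_zero: "(\<lambda>_. 0) \<in> V"
    and V_lin: "x \<in> V \<Longrightarrow> y \<in> V \<Longrightarrow> (\<lambda>e. x e + c * y e) \<in> V"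
    and G_V: "g \<in> G \<Longrightarrow> (\<lambda>e. real (g e)) \<in> V"
    and generator: "x \<in> V \<Longrightarrow> (\<And>e. 0 \<le> x e) \<Longrightarrow> x \<noteq> (\<lambda>_. 0) \<Longrightarrow>
      \<exists>g\<in>G. (\<exists>e. g e \<noteq> 0) \<and> (\<forall>e. g e \<noteq> 0 \<longrightarrow> x e \<noteq> 0)"
begin

text \<open>A linear space cut out by vanishing coordinates, without sign conditions: the projected
  perturbations may have negative coordinates and must still belong to it.\<close>

definition face :: "'e set \<Rightarrow> ('e \<Rightarrow> real) set" where
  "face S = {x \<in> V. \<forall>e. e \<notin> S \<longrightarrow> x e = 0}"

text \<open>Asking this for all rational functionals, not for those met in one pulling step only,
  makes the property inheritable: \<open>proj\<close> has rational coefficients, since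
  \<open>g\<close> is natural-valued.\<close>

definition generic :: "'e set \<Rightarrow> ('e \<Rightarrow> real) \<Rightarrow> bool" where
  "generic S y \<longleftrightarrow> y \<in> face S \<and>
    (\<forall>a. (\<forall>e. a e \<in> \<rat>) \<longrightarrow> (\<Sum>e\<in>E. a e * y e) = 0 \<longrightarrow> (\<forall>x\<in>face S. (\<Sum>e\<in>E. a e * x e) = 0))"

lemma genericD:
  assumes "generic S y" "\<And>e. a e \<in> \<rat>" "(\<Sum>e\<in>E. a e * y e) = 0" "x \<in> face S"
  shows "(\<Sum>e\<in>E. a e * x e) = 0"
  using assms(2-4) assms(1)[unfolded generic_def, THEN conjunct2, rule_format, of a x] by simp

lemma generic_coordinate:
  assumes "generic S y" "y e = 0" "x \<in> face S"
  shows "x e = 0"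
proof (cases "e \<in> E")
  case True
  have eq: "(\<Sum>e'\<in>E. of_bool (e' = e) * z e') = z e" for z :: "'e \<Rightarrow> real"
  proof -
    have "(\<Sum>e'\<in>E. of_bool (e' = e) * z e') = (\<Sum>e'\<in>E. if e' = e then z e' else 0)"
      by (rule sum.cong) auto
    then show ?thesis using True finite_E by simp
  qed
  have 0: "(\<Sum>e'\<in>E. of_bool (e' = e) * y e') = 0" using assms(2) by (simp only: eq)
  have "(\<Sum>e'\<in>E. of_bool (e' = e) * x e') = 0"
    by (rule genericD[OF assms(1) _ 0]) (use assms(3) in \<open>auto simp: of_bool_def\<close>)
  then show ?thesis by (simp only: eq)
qed (use assms V_supp in \<open>auto simp: face_def\<close>)

text \<open>Equality of two ratios of coordinates of \<open>y\<close> to those of \<open>g\<close>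
  is a rational linear relation, so it holds throughout the face. Ties of \<open>y\<close> are
  therefore ties of every \<open>x\<close>.\<close>

lemma generic_ratio:
  assumes "generic S y" "y e * real (g e') = y e' * real (g e)" "x \<in> face S" "e \<in> E" "e' \<in> E"
  shows "x e * real (g e') = x e' * real (g e)"
proof (cases "e = e'")
  case False
  let ?a = "\<lambda>d. of_bool (d = e) * real (g e') - of_bool (d = e') * real (g e)"
  have eq: "(\<Sum>d\<in>E. ?a d * z d) = z e * real (g e') - z e' * real (g e)" for z
  proof -
    have "(\<Sum>d\<in>E. ?a d * z d) = (\<Sum>d\<in>E. (if d = e then z d * real (g e') else 0))
        - (\<Sum>d\<in>E. (if d = e' then z d * real (g e) else 0))"
      unfolding sum_subtractf[symmetric] by (rule sum.cong) (auto simp: algebra_simps)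
    then show ?thesis using assms(4,5) finite_E by simp
  qed
  have 0: "(\<Sum>d\<in>E. ?a d * y d) = 0" using assms(2) by (simp only: eq)
  have "(\<Sum>d\<in>E. ?a d * x d) = 0"
    by (rule genericD[OF assms(1) _ 0]) (use assms(3) in \<open>auto simp: of_bool_def\<close>)
  then show ?thesis by (simp only: eq)
qed (use assms in auto)

lemma proj_face:
  assumes "x \<in> face S" "g \<in> G" "\<And>e. g e \<noteq> 0 \<Longrightarrow> e \<in> S" "g e \<noteq> 0"
  shows "proj g e x \<in> face (S - {e})"
proof -
  have "x \<in> V" using assms(1) by (simp add: face_def)
  from V_lin[OF this G_V[OF assms(2)], of "- (x e / real (g e))"]
  have "proj g e x \<in> V" by (simp add: proj_def)
  then show ?thesis using assms by (auto simp: face_def proj_def)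
qed

text \<open>The functional \<open>a\<close> composed with \<open>proj g e\<close> is
  \<open>a\<close> with the rational number \<open>r\<close> subtracted at \<open>e\<close>, so
  genericity in the larger face applies to it. On the smaller face the projection is the
  identity.\<close>

lemma generic_proj:
  assumes "generic S y" "g \<in> G" "\<And>e. g e \<noteq> 0 \<Longrightarrow> e \<in> S" "g e \<noteq> 0" "S \<subseteq> E"
  shows "generic (S - {e}) (proj g e y)"
  unfolding generic_def
proof (intro conjI allI impI ballI)
  show "proj g e y \<in> face (S - {e})" using assms by (intro proj_face) (auto simp: generic_def)
  fix a :: "'e \<Rightarrow> real" and x
  assume a: "\<forall>e. a e \<in> \<rat>" and 0: "(\<Sum>d\<in>E. a d * proj g e y d) = 0" and x: "x \<in> face (S - {e})"
  define r where "r = (\<Sum>d\<in>E. a d * real (g d)) / real (g e)"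
  have e: "e \<in> E" using assms by auto
  have eq: "(\<Sum>d\<in>E. (a d - of_bool (d = e) * r) * z d) = (\<Sum>d\<in>E. a d * proj g e z d)" for z
  proof -
    have "(\<Sum>d\<in>E. (a d - of_bool (d = e) * r) * z d)
        = (\<Sum>d\<in>E. a d * z d) - (\<Sum>d\<in>E. if d = e then r * z d else 0)"
      unfolding sum_subtractf[symmetric] by (rule sum.cong) (auto simp: algebra_simps)
    also have "\<dots> = (\<Sum>d\<in>E. a d * z d) - z e / real (g e) * (\<Sum>d\<in>E. a d * real (g d))"
      using e finite_E by (simp add: r_def)
    also have "\<dots> = (\<Sum>d\<in>E. a d * proj g e z d)"
      by (simp add: proj_def right_diff_distrib sum_subtractf sum_distrib_left mult_ac)
    finally show ?thesis .
  qed
  have "r \<in> \<rat>" unfolding r_def using a by (intro Rats_divide Rats_sum Rats_mult) auto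
  then have rat: "a d - of_bool (d = e) * r \<in> \<rat>" for d using a by auto
  have "x \<in> face S" using x by (auto simp: face_def)
  then have "(\<Sum>d\<in>E. (a d - of_bool (d = e) * r) * x d) = 0"
    using genericD[OF assms(1), where a = "\<lambda>d. a d - of_bool (d = e) * r"] rat by (simp add: eq 0)
  moreover have "proj g e x = x" using x by (auto simp: face_def proj_def)
  ultimately show "(\<Sum>d\<in>E. a d * x d) = 0" by (simp add: eq)
qed

text \<open>Nonnegativity after projecting at \<open>e\<close> means that the pair of ratios of
  \<open>x\<close> and \<open>y\<close> to \<open>g\<close> is lexicographically least at
  \<open>e\<close>. Applied in both directions, this forces two admissible coordinates to have the
  same ratio for \<open>y\<close>.\<close>

lemma lex_nonneg_proj_ratio:
  assumes "lex_nonneg (proj g e x) (proj g e y)" "g e \<noteq> 0" "g e' \<noteq> 0"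
  shows "x e / real (g e) < x e' / real (g e') \<or>
    x e / real (g e) = x e' / real (g e') \<and> y e / real (g e) \<le> y e' / real (g e')"
proof -
  have "0 < proj g e x e' \<or> proj g e x e' = 0 \<and> 0 \<le> proj g e y e'"
    using assms(1) by (auto simp: lex_nonneg_def)
  moreover have "proj g e z e' = (z e' / real (g e') - z e / real (g e)) * real (g e')" for z
    using assms(3) by (simp add: proj_def field_simps)
  ultimately show ?thesis using assms(3) by (auto simp: zero_less_mult_iff zero_le_mult_iff)
qed

text \<open>For small positive \<epsilon>, x + \<epsilon> y is its projection plus a multiple of
  \<open>g\<close>, and the conditions on \<open>x e\<close> and \<open>y e\<close> say that this
  multiple is nonnegative. Conversely, projecting at a coordinate with the lexicographically least
  ratios keeps all coordinates nonnegative. One representative in \<open>R\<close> for each ratio of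
  \<open>y\<close> suffices, by \<open>generic_ratio\<close>.\<close>

lemma lex_nonneg_proj_iff:
  assumes "generic S y" "x \<in> face S" "\<And>e. g e \<noteq> 0 \<Longrightarrow> e \<in> S" "\<exists>e. g e \<noteq> 0" "S \<subseteq> E"
    and R: "R \<subseteq> {e. g e \<noteq> 0}" "(\<lambda>e. y e / real (g e)) ` R = (\<lambda>e. y e / real (g e)) ` {e. g e \<noteq> 0}"
    and y: "\<And>e. e \<in> R \<Longrightarrow> y e \<noteq> 0"
  shows "lex_nonneg x y \<longleftrightarrow>
    (\<exists>e\<in>R. lex_nonneg (proj g e x) (proj g e y) \<and> 0 \<le> x e \<and> (y e < 0 \<longrightarrow> 0 < x e))"
proof
  assume "\<exists>e\<in>R. lex_nonneg (proj g e x) (proj g e y) \<and> 0 \<le> x e \<and> (y e < 0 \<longrightarrow> 0 < x e)"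
  then obtain e where e: "e \<in> R" "lex_nonneg (proj g e x) (proj g e y)" "0 \<le> x e"
    "y e < 0 \<longrightarrow> 0 < x e" by blast
  have "g e \<noteq> 0" using e R by auto
  show "lex_nonneg x y"
    unfolding lex_nonneg_def
  proof
    fix d
    have "z d = proj g e z d + z e / real (g e) * real (g d)" for z by (simp add: proj_def)
    note this[of x] this[of y]
    moreover have "0 < proj g e x d \<or> proj g e x d = 0 \<and> 0 \<le> proj g e y d"
      using e(2) by (auto simp: lex_nonneg_def)
    moreover have "0 \<le> x e / real (g e) * real (g d)" using e(3) by simp
    moreover have "0 < x e / real (g e) * real (g d) \<or> 0 \<le> y e / real (g e) * real (g d)"
      using e(3,4) \<open>g e \<noteq> 0\<close> by (cases "y e < 0"; cases "g d = 0") auto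
    ultimately show "0 < x d \<or> x d = 0 \<and> 0 \<le> y d" by linarith
  qed
next
  assume lex: "lex_nonneg x y"
  define Z where "Z = {e. g e \<noteq> 0}"
  have Z: "finite Z" "Z \<noteq> {}" "Z \<subseteq> E"
    using assms(3-5) finite_subset[OF _ finite_E, of Z] by (auto simp: Z_def)
  let ?x = "\<lambda>e. x e / real (g e)" and ?y = "\<lambda>e. y e / real (g e)"
  \<comment> \<open>Among the minimizers \<open>Z'\<close> of the ratio of \<open>x\<close>,
    \<open>e0\<close> minimizes the ratio of \<open>y\<close>; \<open>e\<close> is the coordinate in
    \<open>R\<close> that represents \<open>e0\<close>.\<close>
  define Z' where "Z' = {e \<in> Z. \<forall>d\<in>Z. ?x e \<le> ?x d}"
  have "\<exists>e\<in>Z. \<forall>d\<in>Z. ?x e \<le> ?x d"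
    using arg_min_if_finite[OF Z(1,2), of ?x] by (meson not_less)
  then have Z': "finite Z'" "Z' \<noteq> {}" using Z by (auto simp: Z'_def)
  have "\<exists>e\<in>Z'. \<forall>d\<in>Z'. ?y e \<le> ?y d"
    using arg_min_if_finite[OF Z', of ?y] by (meson not_less)
  then obtain e0 where e0: "e0 \<in> Z'" "\<And>d. d \<in> Z' \<Longrightarrow> ?y e0 \<le> ?y d" by blast
  then obtain e where e: "e \<in> R" "?y e = ?y e0" using R unfolding Z'_def Z_def
    by (metis (no_types, lifting) imageE imageI mem_Collect_eq)
  have Ze: "e \<in> Z" "e0 \<in> Z" using e R e0 by (auto simp: Z_def Z'_def)
  have "x e * real (g e0) = x e0 * real (g e)"
    by (rule generic_ratio[OF assms(1) _ assms(2)]) (use e Ze Z in \<open>auto simp: Z_def field_simps\<close>)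
  then have xe: "?x e = ?x e0" using Ze by (auto simp: Z_def field_simps)
  have "0 < proj g e x d \<or> proj g e x d = 0 \<and> 0 \<le> proj g e y d" for d
  proof (cases "d \<in> Z")
    case False
    then have "proj g e z d = z d" for z by (simp add: proj_def Z_def)
    then show ?thesis using lex by (simp add: lex_nonneg_def)
  next
    case True
    then have *: "proj g e z d = (z d / real (g d) - z e / real (g e)) * real (g d)" for z
      by (simp add: proj_def field_simps Z_def)
    have "?x e \<le> ?x d" using e0 True xe by (simp add: Z'_def)
    moreover have "?y e \<le> ?y d" if "?x e = ?x d"
    proof -
      have "d \<in> Z'" using e0(1) True xe that by (simp add: Z'_def)
      then show ?thesis using e0(2) e(2) by simp
    qed
    ultimately show ?thesis
      unfolding * using True by (cases "?x e = ?x d") (auto simp: Z_def intro!: mult_pos_pos)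
  qed
  moreover have "0 < x e \<or> x e = 0 \<and> 0 \<le> y e" using lex by (auto simp: lex_nonneg_def)
  ultimately show "\<exists>e\<in>R. lex_nonneg (proj g e x) (proj g e y) \<and> 0 \<le> x e \<and> (y e < 0 \<longrightarrow> 0 < x e)"
    using e(1) by (intro bexI[of _ e]) (auto simp: lex_nonneg_def)
qed

text \<open>All combinations of \<open>B\<close> vanish at \<open>e\<close> and \<open>g\<close>
  does not. Coordinate \<open>e\<close> thus reads off the coefficient of \<open>g\<close>, and
  \<open>proj g e\<close> removes exactly that term.\<close>

lemma basis_insert:
  assumes "basis_of B (face (S - {e}))" "g \<in> G" "\<And>e. g e \<noteq> 0 \<Longrightarrow> e \<in> S" "g e \<noteq> 0"
  shows "g \<notin> B"
    "proj g e (lincomb (insert g B) c) = lincomb B c" "lincomb (insert g B) c e = c g * real (g e)"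
    "basis_of (insert g B) (face S)"
proof -
  have fin: "finite B" using assms(1) by (simp add: basis_of_def)
  have B0: "lincomb B c e = 0" for c
  proof -
    have "lincomb B c \<in> face (S - {e})" using assms(1) unfolding basis_of_def by blast
    then show ?thesis by (simp add: face_def)
  qed
  show gB: "g \<notin> B"
    using basis_mem[OF assms(1), of g] assms(4) by (auto simp: face_def)
  have val: "lincomb (insert g B) c e = c g * real (g e)" for c
    by (simp add: lincomb_insert[OF fin gB] B0)
  show "lincomb (insert g B) c e = c g * real (g e)" by (rule val)
  have pr: "proj g e (lincomb (insert g B) c) = lincomb B c" for c
    using assms(4) by (simp add: proj_def lincomb_insert[OF fin gB] B0)
  show "proj g e (lincomb (insert g B) c) = lincomb B c" by (rule pr)
  show "basis_of (insert g B) (face S)"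
    unfolding basis_of_def
  proof (intro conjI allI impI ballI iffI)
    fix x assume x: "x \<in> face S"
    then obtain c where c: "proj g e x = lincomb B c"
      using proj_face[OF x assms(2-4)] assms(1) unfolding basis_of_def by blast
    define c' where "c' = c(g := x e / real (g e))"
    have "lincomb B c' = lincomb B c" using gB by (intro lincomb_cong) (auto simp: c'_def)
    then have "lincomb (insert g B) c' = x"
      by (simp add: lincomb_insert[OF fin gB] c[symmetric] c'_def proj_def)
    then show "\<exists>c. x = lincomb (insert g B) c" by metis
  next
    fix x assume "\<exists>c. x = lincomb (insert g B) c"
    then obtain c where c: "x = lincomb (insert g B) c" by blast
    have "lincomb B c \<in> face (S - {e})" using assms(1) unfolding basis_of_def by blast
    then have L: "lincomb B c \<in> V" "\<And>e. e \<notin> S \<Longrightarrow> lincomb B c e = 0" by (auto simp: face_def)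
    have "x = (\<lambda>d. lincomb B c d + c g * real (g d))"
      by (simp add: c lincomb_insert[OF fin gB] add.commute)
    moreover have "g d = 0" if "d \<notin> S" for d using assms(3) that by blast
    ultimately show "x \<in> face S"
      using V_lin[OF L(1) G_V[OF assms(2)], of "c g"] L(2) by (simp add: face_def)
  next
    fix c b assume 0: "lincomb (insert g B) c = (\<lambda>_. 0)" and b: "b \<in> insert g B"
    have "c g = 0" using val[of c] 0 assms(4) by simp
    moreover have "lincomb B c = (\<lambda>_. 0)" using pr[of c] 0 by (simp add: proj_def)
    then have "\<forall>b\<in>B. c b = 0" using assms(1) by (simp add: basis_of_def)
    ultimately show "c b = 0" using b by auto
  qed (use fin in simp)
qed

text \<open>The coefficient of \<open>g\<close> is \<open>x e / g e\<close>, so removing the facet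
  opposite to \<open>g\<close> amounts to requiring \<open>0 < x e\<close>. The flag
  \<open>neg\<close> will be \<open>y e < 0\<close>, where the perturbation pushes points of that
  facet out of the cell.\<close>

lemma half_open_cone_insert:
  assumes "basis_of (fst p) (face (S - {e}))" "g \<in> G" "\<And>e. g e \<noteq> 0 \<Longrightarrow> e \<in> S" "g e \<noteq> 0"
    and "snd p \<subseteq> fst p"
  shows "x \<in> half_open_cone (insert g (fst p), if neg then insert g (snd p) else snd p) \<longleftrightarrow>
    x \<in> face S \<and> proj g e x \<in> half_open_cone p \<and> 0 \<le> x e \<and> (neg \<longrightarrow> 0 < x e)"
proof -
  note ins = basis_insert[OF assms(1-4)]
  have fin: "finite (fst p)" using assms(1) by (simp add: basis_of_def)
  have pos: "0 < real (g e)" using assms(4) by simp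
  show ?thesis
  proof
    assume "x \<in> half_open_cone (insert g (fst p), if neg then insert g (snd p) else snd p)"
    then obtain c where c: "x = lincomb (insert g (fst p)) c" "\<forall>b\<in>insert g (fst p). 0 \<le> c b"
      "\<forall>b\<in>insert g (fst p). b \<in> (if neg then insert g (snd p) else snd p) \<longrightarrow> 0 < c b"
      by (auto simp: half_open_cone_def)
    have "x \<in> face S" using c(1) ins(4) unfolding basis_of_def by blast
    moreover have "proj g e x \<in> half_open_cone p"
      using c ins(2)[of c] by (auto simp: half_open_cone_def split: if_splits)
    moreover have "x e = c g * real (g e)" using ins(3) c(1) by simp
    ultimately show "x \<in> face S \<and> proj g e x \<in> half_open_cone p \<and> 0 \<le> x e \<and> (neg \<longrightarrow> 0 < x e)"
      using c(2,3) pos by (auto intro!: mult_pos_pos mult_nonneg_nonneg)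
  next
    assume x: "x \<in> face S \<and> proj g e x \<in> half_open_cone p \<and> 0 \<le> x e \<and> (neg \<longrightarrow> 0 < x e)"
    then obtain c where c: "proj g e x = lincomb (fst p) c"
      "\<forall>b\<in>fst p. 0 \<le> c b \<and> (b \<in> snd p \<longrightarrow> 0 < c b)"
      by (auto simp: half_open_cone_def)
    define c' where "c' = c(g := x e / real (g e))"
    have "lincomb (fst p) c' = lincomb (fst p) c"
      using ins(1) by (intro lincomb_cong) (auto simp: c'_def)
    then have "x = lincomb (insert g (fst p)) c'"
      by (simp add: lincomb_insert[OF fin ins(1)] c(1)[symmetric] c'_def proj_def)
    moreover have "\<forall>b\<in>insert g (fst p). 0 \<le> c' b \<and>
      (b \<in> (if neg then insert g (snd p) else snd p) \<longrightarrow> 0 < c' b)"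
      using x c(2) pos ins(1) assms(5) by (auto simp: c'_def)
    ultimately show "x \<in> half_open_cone (insert g (fst p), if neg then insert g (snd p) else snd p)"
      unfolding half_open_cone_def by auto
  qed
qed

text \<open>The cells cover the points that are nonnegative after the perturbation, not all
  nonnegative ones; projected perturbations can have negative coordinates, and then boundary points
  are left out. That every cell spans the whole face will yield equal dimensions.\<close>

definition decomposes :: "'e set \<Rightarrow> ('e \<Rightarrow> real) \<Rightarrow> (('e \<Rightarrow> nat) set \<times> ('e \<Rightarrow> nat) set) set \<Rightarrow> bool" where
  "decomposes S y C \<longleftrightarrow> finite C \<and>
    (\<forall>p\<in>C. fst p \<subseteq> G \<and> snd p \<subseteq> fst p \<and> basis_of (fst p) (face S)) \<and>
    (\<forall>x\<in>face S. lex_nonneg x y \<longleftrightarrow> (\<exists>p\<in>C. x \<in> half_open_cone p)) \<and>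
    (\<forall>p\<in>C. \<forall>p'\<in>C. \<forall>x. x \<in> half_open_cone p \<longrightarrow> x \<in> half_open_cone p' \<longrightarrow> p = p')"

lemma decomposes_cover:
  "decomposes S y C \<Longrightarrow> x \<in> face S \<Longrightarrow> lex_nonneg x y \<longleftrightarrow> (\<exists>p\<in>C. x \<in> half_open_cone p)"
  by (simp add: decomposes_def)

lemma decomposes_unique:
  "decomposes S y C \<Longrightarrow> p \<in> C \<Longrightarrow> p' \<in> C \<Longrightarrow> x \<in> half_open_cone p \<Longrightarrow> x \<in> half_open_cone p' \<Longrightarrow> p = p'"
  by (simp add: decomposes_def)

text \<open>Induction on the number of coordinates allowed to be nonzero: cells of the faces
  opposite to \<open>g\<close> are coned over \<open>g\<close>. The zero face is one cell without
  generators, and a face without perturbed nonnegative points gets no cell at all.\<close>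

lemma half_open_decomposition:
  assumes "S \<subseteq> E" "generic S y"
  shows "\<exists>C. decomposes S y C"
  using assms
proof (induction "card S" arbitrary: S y rule: less_induct)
  case less
  have finS: "finite S" using less.prems finite_E finite_subset by blast
  consider "face S \<subseteq> {\<lambda>_. 0}" | "\<forall>x\<in>face S. \<not> lex_nonneg x y"
    | x where "x \<in> face S" "lex_nonneg x y" "\<not> face S \<subseteq> {\<lambda>_. 0}" by blast
  then show ?case
  proof cases
    case 1
    moreover have "(\<lambda>_. 0) \<in> face S" using V_zero by (simp add: face_def)
    ultimately have eq: "face S = {\<lambda>_. 0}" by blast
    then have "y = (\<lambda>_. 0)" using less.prems(2) by (auto simp: generic_def)
    moreover have "lincomb {} c = (\<lambda>_. 0)" for c :: "('e \<Rightarrow> nat) \<Rightarrow> real" by (simp add: lincomb_def fun_eq_iff)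
    ultimately have "decomposes S y {({}, {})}"
      by (simp add: decomposes_def eq basis_of_def half_open_cone_def lex_nonneg_def)
    then show ?thesis ..
  next
    case 2
    then have "decomposes S y {}" by (simp add: decomposes_def)
    then show ?thesis ..
  next
    case (3 x)
    have yS: "y \<in> face S" using less.prems(2) by (simp add: generic_def)
    have "y \<noteq> (\<lambda>_. 0)"
    proof
      assume "y = (\<lambda>_. 0)"
      then have "z e = 0" if "z \<in> face S" for z e
        using generic_coordinate[OF less.prems(2) _ that] by simp
      then show False using 3(3) by (auto simp: fun_eq_iff)
    qed
    \<comment> \<open>If the given point is 0, the perturbation itself is nonnegative, and it is
      nonzero by genericity.\<close>
    have "\<exists>z\<in>face S. z \<noteq> (\<lambda>_. 0) \<and> (\<forall>e. 0 \<le> z e)"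
    proof (cases "x = (\<lambda>_. 0)")
      case True
      then have "0 \<le> y e" for e using 3(2) by (simp add: lex_nonneg_def)
      then show ?thesis using yS \<open>y \<noteq> (\<lambda>_. 0)\<close> by blast
    next
      case False
      moreover have "0 \<le> x e" for e
        using 3(2) unfolding lex_nonneg_def by (metis less_eq_real_def)
      ultimately show ?thesis using 3(1) by blast
    qed
    then obtain z where z: "z \<in> face S" "z \<noteq> (\<lambda>_. 0)" "\<And>e. 0 \<le> z e" by blast
    have "z \<in> V" "\<And>e. z e \<noteq> 0 \<Longrightarrow> e \<in> S" using z(1) by (auto simp: face_def)
    then obtain g where g: "g \<in> G" "\<exists>e. g e \<noteq> 0" "\<And>e. g e \<noteq> 0 \<Longrightarrow> e \<in> S"
      using generator[OF _ z(3,2)] by blast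
    \<comment> \<open>Coordinates with equal ratios give the same condition on \<open>x\<close>;
      keeping one of each class prevents the same piece from being listed twice.\<close>
    obtain R where R: "R \<subseteq> {e. g e \<noteq> 0}" "inj_on (\<lambda>e. y e / real (g e)) R"
      "(\<lambda>e. y e / real (g e)) ` R = (\<lambda>e. y e / real (g e)) ` {e. g e \<noteq> 0}"
      using iffD1[OF subset_image_inj order_refl,
          of "{e. g e \<noteq> 0}" "\<lambda>e. y e / real (g e)"] by metis
    have RS: "R \<subseteq> S" using R(1) g(3) by auto
    then have finR: "finite R" using finS finite_subset by blast
    have gS: "(\<lambda>e. real (g e)) \<in> face S" using G_V[OF g(1)] g(3) by (auto simp: face_def)
    have yR: "y e \<noteq> 0" if "e \<in> R" for e
      using generic_coordinate[OF less.prems(2) _ gS, of e] that R(1) by auto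
    have "\<exists>C. decomposes (S - {e}) (proj g e y) C" if e: "e \<in> R" for e
    proof (rule less.hyps)
      show "card (S - {e}) < card S" using e RS finS by (meson card_Diff1_less subsetD)
      show "S - {e} \<subseteq> E" using less.prems by blast
      show "generic (S - {e}) (proj g e y)"
        using generic_proj[OF less.prems(2) g(1,3) _ less.prems(1)] e R(1) by auto
    qed
    then obtain C where C: "\<And>e. e \<in> R \<Longrightarrow> decomposes (S - {e}) (proj g e y) (C e)" by metis
    define ext where "ext e p = (insert g (fst p), if y e < 0 then insert g (snd p) else snd p)"
      for e and p :: "('e \<Rightarrow> nat) set \<times> ('e \<Rightarrow> nat) set"
    have mem: "x \<in> half_open_cone (ext e p) \<longleftrightarrow>
        x \<in> face S \<and> proj g e x \<in> half_open_cone p \<and> 0 \<le> x e \<and> (y e < 0 \<longrightarrow> 0 < x e)"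
      if "e \<in> R" "p \<in> C e" for e p x
      unfolding ext_def
      by (rule half_open_cone_insert) (use that C R g in \<open>auto simp: decomposes_def\<close>)
    have projface: "proj g e x \<in> face (S - {e})" if "e \<in> R" "x \<in> face S" for e x
      using proj_face[OF that(2) g(1,3)] R(1) that by auto
    \<comment> \<open>Pulling at \<open>g\<close>: subtract from \<open>x + \<epsilon> y\<close> the largest possible multiple of \<open>g\<close>. The coordinate \<open>e\<close>
      that vanishes first is unique up to coordinates proportional on the whole face, and the
      multiple has the sign of \<open>y e\<close> whenever \<open>x e = 0\<close>.\<close>
    define D where "D = (\<Union>e\<in>R. ext e ` C e)"
    have "decomposes S y D"
      unfolding decomposes_def
    proof (intro conjI ballI allI impI)
      show "finite D" using finR C by (auto simp: D_def decomposes_def)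
    next
      fix p assume "p \<in> D"
      then obtain e p0 where p: "e \<in> R" "p0 \<in> C e" "p = ext e p0" by (auto simp: D_def)
      have p0: "fst p0 \<subseteq> G" "snd p0 \<subseteq> fst p0" "basis_of (fst p0) (face (S - {e}))"
        using C[OF p(1)] p(2) by (auto simp: decomposes_def)
      show "fst p \<subseteq> G" "snd p \<subseteq> fst p" using p0 g(1) by (auto simp: p(3) ext_def)
      show "basis_of (fst p) (face S)"
        using basis_insert(4)[OF p0(3) g(1,3)] R(1) p by (auto simp: ext_def)
    next
      fix x assume x: "x \<in> face S"
      have "lex_nonneg x y \<longleftrightarrow>
        (\<exists>e\<in>R. lex_nonneg (proj g e x) (proj g e y) \<and> 0 \<le> x e \<and> (y e < 0 \<longrightarrow> 0 < x e))"
        by (rule lex_nonneg_proj_iff[OF less.prems(2) x g(3,2) less.prems(1) R(1,3) yR])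
      also have "\<dots> \<longleftrightarrow> (\<exists>e\<in>R. \<exists>p\<in>C e. x \<in> half_open_cone (ext e p))"
      proof (rule bex_cong[OF refl])
        fix e assume e: "e \<in> R"
        have "lex_nonneg (proj g e x) (proj g e y) \<longleftrightarrow> (\<exists>p\<in>C e. proj g e x \<in> half_open_cone p)"
          by (rule decomposes_cover[OF C[OF e] projface[OF e x]])
        then show "lex_nonneg (proj g e x) (proj g e y) \<and> 0 \<le> x e \<and> (y e < 0 \<longrightarrow> 0 < x e) \<longleftrightarrow>
          (\<exists>p\<in>C e. x \<in> half_open_cone (ext e p))"
          using mem[OF e] x by auto
      qed
      also have "\<dots> \<longleftrightarrow> (\<exists>p\<in>D. x \<in> half_open_cone p)" by (simp add: D_def)
      finally show "lex_nonneg x y \<longleftrightarrow> (\<exists>p\<in>D. x \<in> half_open_cone p)" .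
    next
      fix p p' x
      assume "p \<in> D" "p' \<in> D" and x: "x \<in> half_open_cone p" "x \<in> half_open_cone p'"
      then obtain e p0 e' p0' where p: "e \<in> R" "p0 \<in> C e" "p = ext e p0"
        "e' \<in> R" "p0' \<in> C e'" "p' = ext e' p0'" by (auto simp: D_def)
      have xp: "x \<in> face S" "proj g e x \<in> half_open_cone p0" "proj g e' x \<in> half_open_cone p0'"
        using x mem p by auto
      then have lex: "lex_nonneg (proj g e x) (proj g e y)" "lex_nonneg (proj g e' x) (proj g e' y)"
        using decomposes_cover[OF C[OF p(1)] projface[OF p(1) xp(1)]]
          decomposes_cover[OF C[OF p(4)] projface[OF p(4) xp(1)]] p by auto
      have "g e \<noteq> 0" "g e' \<noteq> 0" using p R(1) by auto
      with lex_nonneg_proj_ratio[OF lex(1), of e'] lex_nonneg_proj_ratio[OF lex(2), of e]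
      have "y e / real (g e) = y e' / real (g e')" by auto
      then have "e = e'" using R(2) p by (auto dest: inj_onD)
      moreover from this have "p0 = p0'" using decomposes_unique[OF C[OF p(1)] p(2)] p(5) xp by simp
      ultimately show "p = p'" using p by simp
    qed
    then show ?thesis ..
  qed
qed

end

section \<open>Existence of a generic perturbation\<close>

lemma ex_transcendental: "\<exists>z::real. 0 < z \<and> \<not> algebraic z"
proof -
  have "{z::real. algebraic z} \<subseteq>
    (\<Union>l\<in>{l :: int list. Poly l \<noteq> 0}. {z. poly (map_poly of_int (Poly l)) z = 0})"
  proof
    fix z :: real assume "z \<in> {z. algebraic z}"
    then obtain p :: "int poly" where "poly (map_poly of_int p) z = 0" "p \<noteq> 0"
      using algebraicE' by blast
    then show "z \<in> (\<Union>l\<in>{l :: int list. Poly l \<noteq> 0}. {z. poly (map_poly of_int (Poly l)) z = 0})"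
      by (intro UN_I[of "coeffs p"]) auto
  qed
  moreover have "countable (\<Union>l\<in>{l :: int list. Poly l \<noteq> 0}.
      {z::real. poly (map_poly of_int (Poly l)) z = 0})"
  proof (rule countable_UN[OF _ countable_finite[OF poly_roots_finite]])
    fix l :: "int list" assume "l \<in> {l. Poly l \<noteq> 0}"
    then obtain i where "coeff (Poly l) i \<noteq> 0" by (metis coeff_0 mem_Collect_eq poly_eqI)
    then have "coeff (map_poly of_int (Poly l) :: real poly) i \<noteq> 0" by (simp add: coeff_map_poly)
    then show "(map_poly of_int (Poly l) :: real poly) \<noteq> 0" by (metis coeff_0)
  qed (rule countableI_type)
  ultimately have "countable {z::real. algebraic z}" by (rule countable_subset)
  moreover have "uncountable {0::real<..<1}" by (simp add: uncountable_open_interval)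
  ultimately have "\<not> {0::real<..<1} \<subseteq> {z. algebraic z}" using countable_subset by blast
  then show ?thesis by auto
qed

text \<open>The weights are distinct powers of a positive transcendental number: a nontrivial
  rational relation between them would be a nonzero rational polynomial with that number as a
  root.\<close>

lemma rationally_independent_weights:
  assumes "finite G"
  shows "\<exists>u :: 'g \<Rightarrow> real. (\<forall>g. 0 < u g) \<and>
    (\<forall>r. (\<forall>g\<in>G. r g \<in> \<rat>) \<longrightarrow> (\<Sum>g\<in>G. r g * u g) = 0 \<longrightarrow> (\<forall>g\<in>G. r g = 0))"
proof -
  obtain z :: real where z: "0 < z" "\<not> algebraic z" using ex_transcendental by blast
  obtain f :: "'g \<Rightarrow> nat" where f: "inj_on f G"
    using finite_imp_inj_to_nat_seg[OF assms] by blast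
  have "r g = 0" if r: "\<forall>g\<in>G. r g \<in> \<rat>" and 0: "(\<Sum>g\<in>G. r g * z ^ f g) = 0" and g: "g \<in> G"
    for r g
  proof -
    define p where "p = (\<Sum>g\<in>G. monom (r g) (f g))"
    have "poly p z = 0" using 0 by (simp add: p_def poly_sum poly_monom)
    moreover have "coeff p i \<in> \<rat>" for i unfolding p_def coeff_sum
      by (rule Rats_sum) (use r in auto)
    ultimately have "p = 0" using z(2) algebraicI' by blast
    have "coeff p (f g) = (\<Sum>g'\<in>G. if g' = g then r g' else 0)"
      unfolding p_def coeff_sum by (rule sum.cong) (use f g in \<open>auto dest: inj_onD\<close>)
    also have "\<dots> = r g" using assms g by simp
    finally show ?thesis using \<open>p = 0\<close> by simp
  qed
  then show ?thesis using z(1) by (intro exI[of _ "\<lambda>g. z ^ f g"]) auto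
qed

lemma lincomb_update:
  assumes "finite B" "b \<in> B"
  shows "lincomb B (c(b := c b + t)) = (\<lambda>e. lincomb B c e + t * real (b e))"
proof
  fix e
  have "lincomb B (c(b := c b + t)) e
      = (\<Sum>b'\<in>B. c b' * real (b' e) + (if b' = b then t * real (b' e) else 0))"
    unfolding lincomb_def by (rule sum.cong) (auto simp: algebra_simps)
  then show "lincomb B (c(b := c b + t)) e = lincomb B c e + t * real (b e)"
    using assms by (simp add: sum.distrib lincomb_def)
qed

text \<open>Nothing forces \<open>H\<close> to be finite or \<open>W\<close> to be spanned by its
  nonnegative vectors. One generator for each possible support gives a finite \<open>G\<close>, and
  its span \<open>V\<close> still contains every nonnegative vector of \<open>W\<close>; the pulling
  takes place in \<open>V\<close>.\<close>

lemma nonneg_cone_decomposition: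
  fixes E :: "'e set" and W :: "('e \<Rightarrow> real) set" and H :: "('e \<Rightarrow> nat) set"
  assumes fin: "finite E"
    and supp: "\<And>x e. x \<in> W \<Longrightarrow> e \<notin> E \<Longrightarrow> x e = 0"
    and zero: "(\<lambda>_. 0) \<in> W"
    and lin: "\<And>x y c. x \<in> W \<Longrightarrow> y \<in> W \<Longrightarrow> (\<lambda>e. x e + c * y e) \<in> W"
    and HW: "\<And>g. g \<in> H \<Longrightarrow> (\<lambda>e. real (g e)) \<in> W"
    and gen: "\<And>x. x \<in> W \<Longrightarrow> (\<And>e. 0 \<le> x e) \<Longrightarrow> x \<noteq> (\<lambda>_. 0) \<Longrightarrow>
      \<exists>g\<in>H. (\<exists>e. g e \<noteq> 0) \<and> (\<forall>e. g e \<noteq> 0 \<longrightarrow> x e \<noteq> 0)"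
  shows "\<exists>C U. finite C \<and>
    (\<forall>p\<in>C. fst p \<subseteq> H \<and> snd p \<subseteq> fst p \<and> basis_of (fst p) U) \<and>
    {x \<in> W. \<forall>e. 0 \<le> x e} = (\<Union>p\<in>C. half_open_cone p) \<and>
    (\<forall>p\<in>C. \<forall>p'\<in>C. \<forall>x. x \<in> half_open_cone p \<longrightarrow> x \<in> half_open_cone p' \<longrightarrow> p = p')"
proof -
  define good where "good S g \<longleftrightarrow> g \<in> H \<and> (\<exists>e. g e \<noteq> 0) \<and> (\<forall>e. g e \<noteq> 0 \<longrightarrow> e \<in> S)" for S g
  define pick where "pick S = (SOME g. good S g)" for S
  define G where "G = pick ` {S \<in> Pow E. \<exists>g. good S g}"
  define V where "V = range (lincomb G)"
  have pick: "good S (pick S)" if "good S g" for S g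
    unfolding pick_def using that by (rule someI[of "good S"])
  have finG: "finite G" using fin by (simp add: G_def)
  have GH: "G \<subseteq> H" using pick by (auto simp: G_def good_def)
  have ex_G: "\<exists>g\<in>G. (\<exists>e. g e \<noteq> 0) \<and> (\<forall>e. g e \<noteq> 0 \<longrightarrow> x e \<noteq> 0)"
    if x: "x \<in> W" "\<And>e. 0 \<le> x e" "x \<noteq> (\<lambda>_. 0)" for x
  proof -
    define S where "S = {e. x e \<noteq> 0}"
    obtain g where "good S g" using gen[OF x] by (auto simp: good_def S_def)
    moreover have "S \<subseteq> E" using supp[OF x(1)] by (auto simp: S_def)
    ultimately have "pick S \<in> G" "good S (pick S)" using pick by (auto simp: G_def)
    then show ?thesis by (auto simp: good_def S_def)
  qed
  have lincomb_W: "lincomb A c \<in> W" if "finite A" "A \<subseteq> G" for A c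
    using that
  proof (induction A rule: finite_induct)
    case empty
    have "lincomb {} c = (\<lambda>_. 0)" by (simp add: lincomb_def fun_eq_iff)
    then show ?case using zero by simp
  next
    case (insert g A)
    then have "(\<lambda>e. lincomb A c e + c g * real (g e)) \<in> W" using GH by (intro lin HW) auto
    then show ?case using insert.hyps by (simp add: lincomb_insert add.commute)
  qed
  have VW: "V \<subseteq> W" using lincomb_W[OF finG] by (auto simp: V_def)
  have WV: "x \<in> V" if "x \<in> W" "\<And>e. 0 \<le> x e" for x
    using that
  proof (induction "card {e. x e \<noteq> 0}" arbitrary: x rule: less_induct)
    case less
    show ?case
    proof (cases "x = (\<lambda>_. 0)")
      case True
      then have "x = lincomb G (\<lambda>_. 0)" by (simp add: lincomb_def fun_eq_iff)
      then show ?thesis by (simp add: V_def)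
    next
      case False
      then obtain g where g: "g \<in> G" "\<exists>e. g e \<noteq> 0" "\<And>e. g e \<noteq> 0 \<Longrightarrow> x e \<noteq> 0"
        using ex_G[OF less.prems] by blast
      define Z where "Z = {e. g e \<noteq> 0}"
      have finx: "finite {e. x e \<noteq> 0}"
        by (rule finite_subset[OF _ fin]) (use supp[OF less.prems(1)] in auto)
      have Z: "finite Z" "Z \<noteq> {}"
        using g(2,3) finite_subset[OF _ finx, of Z] by (auto simp: Z_def)
      define e where "e = arg_min_on (\<lambda>e. x e / real (g e)) Z"
      have e: "e \<in> Z" "\<And>d. d \<in> Z \<Longrightarrow> x e / real (g e) \<le> x d / real (g d)"
        using arg_min_if_finite[OF Z, of "\<lambda>e. x e / real (g e)"] by (auto simp: e_def not_less)
      \<comment> \<open>The largest multiple of \<open>g\<close> that leaves a nonnegative vector is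
        subtracted, which empties coordinate \<open>e\<close> of the support.\<close>
      define x' where "x' = (\<lambda>d. x d + - (x e / real (g e)) * real (g d))"
      have x'W: "x' \<in> W" unfolding x'_def using less.prems(1) g(1) GH by (intro lin HW) auto
      have x'0: "0 \<le> x' d" for d
      proof (cases "d \<in> Z")
        case True
        then show ?thesis using e(2)[OF True] by (simp add: x'_def Z_def field_simps)
      qed (use less.prems(2) in \<open>simp add: x'_def Z_def\<close>)
      have "{e. x' e \<noteq> 0} \<subset> {e. x e \<noteq> 0}"
      proof
        show "{e. x' e \<noteq> 0} \<subseteq> {e. x e \<noteq> 0}" using g(3) by (auto simp: x'_def)
        have "x' e = 0" "x e \<noteq> 0" using e(1) g(3) by (auto simp: x'_def Z_def)
        then show "{e. x' e \<noteq> 0} \<noteq> {e. x e \<noteq> 0}" by blast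
      qed
      then have "x' \<in> V" using less.hyps[OF psubset_card_mono[OF finx] x'W x'0] by blast
      then obtain c where c: "x' = lincomb G c" by (auto simp: V_def)
      have "x = lincomb G (c(g := c g + x e / real (g e)))"
        unfolding lincomb_update[OF finG g(1)] c[symmetric] by (simp add: x'_def)
      then show ?thesis by (simp add: V_def)
    qed
  qed
  interpret pulling E V G
  proof
    show "finite E" by (rule fin)
    show "x e = 0" if "x \<in> V" "e \<notin> E" for x e using that VW supp by blast
    have "(\<lambda>_. 0) = lincomb G (\<lambda>_. 0)" by (simp add: lincomb_def fun_eq_iff)
    then show "(\<lambda>_. 0) \<in> V" by (simp add: V_def)
    show "(\<lambda>e. x e + c * y e) \<in> V" if xy: "x \<in> V" "y \<in> V" for x y c
    proof -
      obtain a b where "x = lincomb G a" "y = lincomb G b" using xy by (auto simp: V_def)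
      then have "(\<lambda>e. x e + c * y e) = lincomb G (\<lambda>g. a g + c * b g)"
        by (simp add: lincomb_def fun_eq_iff sum.distrib sum_distrib_left algebra_simps)
      then show ?thesis by (simp add: V_def)
    qed
    show "(\<lambda>e. real (g e)) \<in> V" if "g \<in> G" for g
      using lincomb_single[OF finG that] by (metis V_def rangeI)
    show "\<exists>g\<in>G. (\<exists>e. g e \<noteq> 0) \<and> (\<forall>e. g e \<noteq> 0 \<longrightarrow> x e \<noteq> 0)"
      if "x \<in> V" "\<And>e. 0 \<le> x e" "x \<noteq> (\<lambda>_. 0)" for x using ex_G that VW by blast
  qed
  obtain u :: "('e \<Rightarrow> nat) \<Rightarrow> real" where u: "\<And>g. 0 < u g"
    "\<And>r. (\<forall>g\<in>G. r g \<in> \<rat>) \<Longrightarrow> (\<Sum>g\<in>G. r g * u g) = 0 \<Longrightarrow> (\<forall>g\<in>G. r g = 0)"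
    using rationally_independent_weights[OF finG] by auto
  define y where "y = lincomb G u"
  have faceE: "face E = V" using V_supp by (auto simp: face_def)
  have swap: "(\<Sum>e\<in>E. a e * lincomb G c e) = (\<Sum>g\<in>G. (\<Sum>e\<in>E. a e * real (g e)) * c g)" for a c
    unfolding lincomb_def sum_distrib_left sum_distrib_right by (subst sum.swap) (simp add: mult_ac)
  \<comment> \<open>A rational functional takes rational values on the generators, so its value at
    \<open>y\<close> is a rational combination of the weights and vanishes only if it vanishes on
    all of \<open>G\<close>.\<close>
  have "generic E y"
    unfolding generic_def faceE
  proof (intro conjI allI impI ballI)
    show "y \<in> V" by (simp add: y_def V_def)
    fix a :: "'e \<Rightarrow> real" and x
    assume a: "\<forall>e. a e \<in> \<rat>" "(\<Sum>e\<in>E. a e * y e) = 0" and "x \<in> V"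
    then obtain c where c: "x = lincomb G c" by (auto simp: V_def)
    have "\<forall>g\<in>G. (\<Sum>e\<in>E. a e * real (g e)) \<in> \<rat>"
      using a(1) by (intro ballI Rats_sum Rats_mult) auto
    then have "\<forall>g\<in>G. (\<Sum>e\<in>E. a e * real (g e)) = 0"
      using a(2) unfolding y_def swap by (rule u(2))
    then show "(\<Sum>e\<in>E. a e * x e) = 0" unfolding c swap by simp
  qed
  from half_open_decomposition[OF order_refl this]
  obtain C where C: "decomposes E y C" by blast
  have "0 \<le> y e" for e
    unfolding y_def lincomb_def by (intro sum_nonneg mult_nonneg_nonneg) (use u(1) less_imp_le in auto)
  then have lex: "lex_nonneg x y \<longleftrightarrow> (\<forall>e. 0 \<le> x e)" for x
    unfolding lex_nonneg_def by (metis less_eq_real_def)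
  have "half_open_cone p \<subseteq> V" if "p \<in> C" for p
    using C that by (auto simp: decomposes_def faceE basis_of_def half_open_cone_def)
  then have sub: "(\<Union>p\<in>C. half_open_cone p) \<subseteq> V" by blast
  have "{x \<in> W. \<forall>e. 0 \<le> x e} = {x \<in> V. \<forall>e. 0 \<le> x e}" using WV VW by auto
  also have "\<dots> = {x \<in> V. \<exists>p\<in>C. x \<in> half_open_cone p}"
    using decomposes_cover[OF C, unfolded lex faceE] by auto
  also have "\<dots> = (\<Union>p\<in>C. half_open_cone p)" using sub by auto
  finally have "{x \<in> W. \<forall>e. 0 \<le> x e} = (\<Union>p\<in>C. half_open_cone p)" .
  moreover have "\<forall>p\<in>C. fst p \<subseteq> H \<and> snd p \<subseteq> fst p \<and> basis_of (fst p) V"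
    using C GH by (auto simp: decomposes_def faceE)
  moreover have "finite C" using C by (simp add: decomposes_def)
  moreover have "\<forall>p\<in>C. \<forall>p'\<in>C. \<forall>x. x \<in> half_open_cone p \<longrightarrow> x \<in> half_open_cone p' \<longrightarrow> p = p'"
    using decomposes_unique[OF C] by blast
  ultimately show ?thesis by (intro exI[of _ C] exI[of _ V] conjI)
qed

section \<open>Generating functions of lattice points\<close>

lemma fps2_of_poly2_nth [simp]: "fps_nth (fps_nth (fps2_of_poly2 P) m) d = coeff (coeff P m) d"
  by (simp add: fps2_of_poly2_def coeff_map_poly)

lemma fps2_of_poly2_0 [simp]: "fps2_of_poly2 0 = 0"
  and fps2_of_poly2_1 [simp]: "fps2_of_poly2 1 = 1"
  by (simp_all add: fps2_of_poly2_def)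

lemma fps2_of_poly2_add: "fps2_of_poly2 (P + Q) = fps2_of_poly2 P + fps2_of_poly2 Q"
  by (intro fps_ext) simp

lemma fps2_of_poly2_mult: "fps2_of_poly2 (P * Q) = fps2_of_poly2 P * fps2_of_poly2 Q"
proof (rule fps_ext)
  fix m
  show "fps_nth (fps2_of_poly2 (P * Q)) m = fps_nth (fps2_of_poly2 P * fps2_of_poly2 Q) m"
    by (simp add: fps2_of_poly2_def coeff_map_poly coeff_mult fps_mult_nth fps_of_poly_sum
        fps_of_poly_mult atLeast0AtMost)
qed

lemma fps2_of_poly2_sum: "fps2_of_poly2 (sum f A) = (\<Sum>x\<in>A. fps2_of_poly2 (f x))"
  by (induction A rule: infinite_finite_induct) (simp_all add: fps2_of_poly2_add)

lemma fps2_of_poly2_eq_0_iff: "fps2_of_poly2 P = 0 \<longleftrightarrow> P = 0"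
proof
  assume "fps2_of_poly2 P = 0"
  then have "coeff (coeff P m) d = 0" for m d by (metis fps2_of_poly2_nth fps_zero_nth)
  then show "P = 0" by (intro poly_eqI) simp
qed simp

lemma coeff_eval_q1 [simp]: "coeff (eval_q1 P) m = poly (coeff P m) 1"
  by (simp add: eval_q1_def coeff_map_poly)

lemma eval_q1_1 [simp]: "eval_q1 1 = 1"
  by (simp add: eval_q1_def)

lemma eval_q1_sum: "eval_q1 (sum f A) = (\<Sum>x\<in>A. eval_q1 (f x))"
  by (intro poly_eqI) (simp add: coeff_sum poly_sum)

lemma eval_q1_mult: "eval_q1 (P * Q) = eval_q1 P * eval_q1 Q"
  by (intro poly_eqI) (simp add: coeff_mult poly_sum)

lemma eval_q1_prod: "eval_q1 (prod f A) = (\<Prod>x\<in>A. eval_q1 (f x))"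
  by (induction A rule: infinite_finite_induct) (simp_all add: eval_q1_mult)

lemma eval_q1_prod_mset: "eval_q1 (\<Prod>x\<in>#A. f x) = (\<Prod>x\<in>#A. eval_q1 (f x))"
  by (induction A) (simp_all add: eval_q1_mult)

section \<open>The factors 1 - q^j t and their cancellation\<close>

definition lin_factor :: "nat \<Rightarrow> int poly poly" where
  "lin_factor j = [:1, - monom 1 j:]"

lemma eval_q1_lin_factor: "eval_q1 (lin_factor j) = [:1, - 1:]"
  by (intro poly_eqI) (simp add: lin_factor_def coeff_pCons poly_monom split: nat.split)

lemma fps2_of_poly2_lin_factor:
  "fps2_of_poly2 (lin_factor j) = 1 - fps_X * fps_const (fps_X ^ j)"
  by (intro fps_ext)
    (auto simp: lin_factor_def coeff_pCons fps_X_power_nth fps_one_nth split: nat.split)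

text \<open>The degree in t is 1, so one of two factors is constant in t; that factor divides the
  coefficient 1 of t^0 and is a unit.\<close>

lemma irreducible_lin_factor: "irreducible (lin_factor j)"
proof (rule irreducibleI)
  show "lin_factor j \<noteq> 0" by (simp add: lin_factor_def)
  have deg: "degree (lin_factor j) = 1" by (simp add: lin_factor_def)
  show "\<not> lin_factor j dvd 1"
  proof
    assume "lin_factor j dvd 1"
    then show False using deg by (metis is_unit_poly_iff degree_pCons_0 zero_neq_one)
  qed
  fix a b assume ab: "lin_factor j = a * b"
  have nz: "a \<noteq> 0" "b \<noteq> 0" using ab deg by auto
  have unit: "c dvd 1" if c: "lin_factor j = c * d" and "degree c = 0" for c d
  proof -
    obtain c0 where c0: "c = [:c0:]" using \<open>degree c = 0\<close> by (rule degree_eq_zeroE)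
    have "1 = coeff (lin_factor j) 0" by (simp add: lin_factor_def)
    also have "\<dots> = c0 * coeff d 0" unfolding c c0 by simp
    finally have "c0 dvd 1" by (metis dvdI)
    then show ?thesis unfolding c0 by (simp add: is_unit_const_poly_iff)
  qed
  have "degree a + degree b = 1" using deg ab degree_mult_eq[OF nz] by simp
  then have "degree a = 0 \<or> degree b = 0" by linarith
  then show "a dvd 1 \<or> b dvd 1"
    using unit[of a b] unit[of b a] ab by (auto simp: mult.commute)
qed

text \<open>An irreducible factor either divides the current numerator and is cancelled, or is
  coprime to it and is kept in \<open>J\<close>. Later divisions of the numerator do not affect
  coprimality with the factors already kept.\<close>

lemma cancel_lin_factors:
  "\<exists>J P. J \<subseteq># J0 \<and> P0 = P * (\<Prod>j\<in>#J0 - J. lin_factor j) \<and> coprime P (\<Prod>j\<in>#J. lin_factor j)"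
proof (induction J0 arbitrary: P0)
  case empty
  then show ?case by (intro exI[of _ "{#}"] exI[of _ P0]) simp
next
  case (add i J0)
  from add.IH[of P0] obtain J P where J: "J \<subseteq># J0" "P0 = P * (\<Prod>j\<in>#J0 - J. lin_factor j)"
    "coprime P (\<Prod>j\<in>#J. lin_factor j)" by blast
  show ?case
  proof (cases "lin_factor i dvd P")
    case True
    then obtain P' where P': "P = P' * lin_factor i" by (metis dvdE mult.commute)
    have "coprime P' (\<Prod>j\<in>#J. lin_factor j)" using J(3) by (simp add: P' coprime_mult_left_iff)
    moreover have "add_mset i J0 - J = add_mset i (J0 - J)"
      using J(1) by (intro multiset_eqI) (auto simp: subseteq_mset_def Suc_diff_le)
    then have "P0 = P' * (\<Prod>j\<in>#add_mset i J0 - J. lin_factor j)"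
      by (simp add: J(2) P' mult.assoc)
    moreover have "J \<subseteq># add_mset i J0" using J(1) by (auto simp: subseteq_mset_def le_SucI)
    ultimately show ?thesis by blast
  next
    case False
    then have "coprime P (lin_factor i)"
      using prime_elem_imp_coprime[OF irreducible_imp_prime_elem_gcd[OF irreducible_lin_factor]]
      by (simp add: coprime_commute)
    then have "coprime P (\<Prod>j\<in>#add_mset i J. lin_factor j)"
      using J(3) by (simp add: coprime_mult_right_iff)
    then show ?thesis using J by (intro exI[of _ "add_mset i J"] exI[of _ P]) auto
  qed
qed

(* The coordinate z is counted by t, the total over A by q. A junk value arises where a fibre is
   infinite, which does not happen for X inside supported (insert z A). *)
definition lattice_gf :: "'e \<Rightarrow> 'e set \<Rightarrow> ('e \<Rightarrow> nat) set \<Rightarrow> int fps fps" where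
  "lattice_gf z A X = Abs_fps (\<lambda>m. Abs_fps (\<lambda>d. int (card {x \<in> X. x z = m \<and> sum x A = d})))"

definition supported :: "'e set \<Rightarrow> ('e \<Rightarrow> nat) set" where
  "supported E = {x. \<forall>e. e \<notin> E \<longrightarrow> x e = 0}"

lemma finite_supported_bounded:
  assumes "finite E"
  shows "finite {x \<in> supported E. \<forall>e\<in>E. x e \<le> N}"
proof (rule finite_subset)
  show "{x \<in> supported E. \<forall>e\<in>E. x e \<le> N}
      \<subseteq> {x. \<forall>e. (e \<in> E \<longrightarrow> x e \<in> {..N}) \<and> (e \<notin> E \<longrightarrow> x e = 0)}"
    by (auto simp: supported_def)
qed (rule finite_set_of_finite_funs[OF assms], simp)

lemma finite_fiber:
  assumes "finite A" "X \<subseteq> supported (insert z A)"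
  shows "finite {x \<in> X. x z = m \<and> sum x A = d}"
proof (rule finite_subset)
  show "{x \<in> X. x z = m \<and> sum x A = d}
      \<subseteq> {x \<in> supported (insert z A). \<forall>e\<in>insert z A. x e \<le> m + d}"
    using assms member_le_sum[of _ A] by (auto intro: trans_le_add2)
qed (rule finite_supported_bounded, use assms in simp)

lemma lattice_gf_UN:
  assumes "finite A" "finite I" "\<And>i. i \<in> I \<Longrightarrow> X i \<subseteq> supported (insert z A)"
    and "\<And>i j. i \<in> I \<Longrightarrow> j \<in> I \<Longrightarrow> i \<noteq> j \<Longrightarrow> X i \<inter> X j = {}"
  shows "lattice_gf z A (\<Union>i\<in>I. X i) = (\<Sum>i\<in>I. lattice_gf z A (X i))"
proof (intro fps_ext)
  fix m d
  have "{x \<in> \<Union>i\<in>I. X i. x z = m \<and> sum x A = d} = (\<Union>i\<in>I. {x \<in> X i. x z = m \<and> sum x A = d})"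
    by auto
  moreover have "card (\<Union>i\<in>I. {x \<in> X i. x z = m \<and> sum x A = d})
      = (\<Sum>i\<in>I. card {x \<in> X i. x z = m \<and> sum x A = d})"
  proof (intro card_UN_disjoint ballI impI)
    show "finite {x \<in> X i. x z = m \<and> sum x A = d}" if "i \<in> I" for i
      by (rule finite_fiber[OF assms(1) assms(3)[OF that]])
    show "{x \<in> X i. x z = m \<and> sum x A = d} \<inter> {x \<in> X j. x z = m \<and> sum x A = d} = {}"
      if "i \<in> I" "j \<in> I" "i \<noteq> j" for i j
      using assms(4)[OF that] by blast
  qed (rule assms(2))
  ultimately show "fps_nth (fps_nth (lattice_gf z A (\<Union>i\<in>I. X i)) m) d
      = fps_nth (fps_nth (\<Sum>i\<in>I. lattice_gf z A (X i)) m) d"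
    by (simp add: lattice_gf_def fps_sum_nth)
qed

lemma lattice_gf_Un:
  assumes "finite A" "X \<subseteq> supported (insert z A)" "X' \<subseteq> supported (insert z A)" "X \<inter> X' = {}"
  shows "lattice_gf z A (X \<union> X') = lattice_gf z A X + lattice_gf z A X'"
proof (intro fps_ext)
  fix m d
  have "{x \<in> X \<union> X'. x z = m \<and> sum x A = d}
      = {x \<in> X. x z = m \<and> sum x A = d} \<union> {x \<in> X'. x z = m \<and> sum x A = d}" by auto
  then have "card {x \<in> X \<union> X'. x z = m \<and> sum x A = d}
      = card {x \<in> X. x z = m \<and> sum x A = d} + card {x \<in> X'. x z = m \<and> sum x A = d}"
    using assms by (simp add: card_Un_disjoint finite_fiber disjoint_iff)
  then show "fps_nth (fps_nth (lattice_gf z A (X \<union> X')) m) d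
      = fps_nth (fps_nth (lattice_gf z A X + lattice_gf z A X') m) d"
    by (simp add: lattice_gf_def)
qed

lemma lattice_gf_shift:
  assumes "b z = 1"
  shows "lattice_gf z A ((\<lambda>x e. x e + b e) ` X)
    = fps_X * fps_const (fps_X ^ sum b A) * lattice_gf z A X"
proof (intro fps_ext)
  fix m d
  let ?s = "\<lambda>x e. x e + b e"
  have inj: "inj_on ?s Z" for Z by (rule inj_onI) (auto simp: fun_eq_iff)
  have "{x \<in> ?s ` X. x z = m \<and> sum x A = d} =
    (if m = 0 \<or> d < sum b A then {} else ?s ` {x \<in> X. x z = m - 1 \<and> sum x A = d - sum b A})"
    using assms by (auto simp: sum.distrib)
  then have "card {x \<in> ?s ` X. x z = m \<and> sum x A = d} =
    (if m = 0 \<or> d < sum b A then 0 else card {x \<in> X. x z = m - 1 \<and> sum x A = d - sum b A})"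
    by (simp add: card_image[OF inj])
  then show "fps_nth (fps_nth (lattice_gf z A (?s ` X)) m) d
      = fps_nth (fps_nth (fps_X * fps_const (fps_X ^ sum b A) * lattice_gf z A X) m) d"
    by (simp add: lattice_gf_def mult.assoc fps_X_power_mult_nth)
qed

lemma lattice_gf_finite:
  assumes "finite X"
  shows "lattice_gf z A X = fps2_of_poly2 (\<Sum>x\<in>X. monom (monom 1 (sum x A)) (x z))"
proof (intro fps_ext)
  fix m d
  have "int (card {x \<in> X. x z = m \<and> sum x A = d}) = (\<Sum>x\<in>X. if x z = m \<and> sum x A = d then 1 else 0)"
    by (simp add: card_filter_eq_sum[OF assms] if_distrib[of int] cong: if_cong)
  also have "\<dots> = (\<Sum>x\<in>X. coeff (coeff (monom (monom 1 (sum x A)) (x z)) m) d)"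
    by (rule sum.cong) auto
  finally show "fps_nth (fps_nth (lattice_gf z A X) m) d
      = fps_nth (fps_nth (fps2_of_poly2 (\<Sum>x\<in>X. monom (monom 1 (sum x A)) (x z))) m) d"
    by (simp add: lattice_gf_def coeff_sum)
qed

(* Lattice points of the cell p whose coefficients outside D lie in a half-open unit interval, so
   that D = {} gives the lattice points of the fundamental parallelepiped. *)
definition partial_cone ::
    "('e \<Rightarrow> nat) set \<times> ('e \<Rightarrow> nat) set \<Rightarrow> ('e \<Rightarrow> nat) set \<Rightarrow> ('e \<Rightarrow> nat) set" where
  "partial_cone p D = {x. \<exists>c. (\<lambda>e. real (x e)) = lincomb (fst p) c \<and>
    (\<forall>b\<in>fst p. 0 \<le> c b \<and> (b \<in> snd p \<longrightarrow> 0 < c b)) \<and>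
    (\<forall>b\<in>fst p - D. if b \<in> snd p then c b \<le> 1 else c b < 1)}"

lemma partial_cone_full: "partial_cone p (fst p) = {x. (\<lambda>e. real (x e)) \<in> half_open_cone p}"
  by (auto simp: partial_cone_def half_open_cone_def)

text \<open>Once the coefficient of \<open>b\<close> is unbounded, it either lies in the first unit
  interval or can be lowered by 1. The interval is (0,1] for \<open>b\<close> in
  \<open>snd p\<close> and [0,1) otherwise, so its integer translates tile the allowed ray.
  Coefficients are unique, hence the two parts are disjoint.\<close>

lemma partial_cone_insert:
  assumes B: "basis_of (fst p) U" and b: "b \<in> fst p" "b \<notin> D"
  shows "partial_cone p (insert b D) =
      partial_cone p D \<union> (\<lambda>x e. x e + b e) ` partial_cone p (insert b D)" (is ?union)
    and "partial_cone p D \<inter> (\<lambda>x e. x e + b e) ` partial_cone p (insert b D) = {}" (is ?disj)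
proof -
  have fin: "finite (fst p)" using B by (simp add: basis_of_def)
  note upd = lincomb_update[OF fin b(1)]
  have shift: "(\<lambda>e. x e + b e) \<in> partial_cone p (insert b D)" if x: "x \<in> partial_cone p (insert b D)" for x
  proof -
    obtain c where c: "(\<lambda>e. real (x e)) = lincomb (fst p) c"
      "\<forall>b\<in>fst p. 0 \<le> c b \<and> (b \<in> snd p \<longrightarrow> 0 < c b)"
      "\<forall>d\<in>fst p - insert b D. if d \<in> snd p then c d \<le> 1 else c d < 1"
      using x by (auto simp: partial_cone_def)
    have "(\<lambda>e. real (x e + b e)) = lincomb (fst p) (c(b := c b + 1))"
      unfolding upd using c(1) by (simp add: fun_eq_iff)
    then show ?thesis unfolding partial_cone_def
      using c(2,3) b(1) by (intro CollectI exI[of _ "c(b := c b + 1)"]) auto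
  qed
  show ?union
  proof
    show "partial_cone p (insert b D) \<subseteq>
        partial_cone p D \<union> (\<lambda>x e. x e + b e) ` partial_cone p (insert b D)"
    proof
      fix x assume "x \<in> partial_cone p (insert b D)"
      then obtain c where c: "(\<lambda>e. real (x e)) = lincomb (fst p) c"
        "\<forall>b\<in>fst p. 0 \<le> c b \<and> (b \<in> snd p \<longrightarrow> 0 < c b)"
        "\<forall>d\<in>fst p - insert b D. if d \<in> snd p then c d \<le> 1 else c d < 1"
        by (auto simp: partial_cone_def)
      show "x \<in> partial_cone p D \<union> (\<lambda>x e. x e + b e) ` partial_cone p (insert b D)"
      proof (cases "if b \<in> snd p then c b \<le> 1 else c b < 1")
        case True
        have "if d \<in> snd p then c d \<le> 1 else c d < 1" if "d \<in> fst p - D" for d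
          using c(3) True that by (cases "d = b") auto
        then have "x \<in> partial_cone p D" unfolding partial_cone_def using c(1,2) by blast
        then show ?thesis by blast
      next
        case False
        define c' where "c' = c(b := c b + (-1))"
        have c': "lincomb (fst p) c' = (\<lambda>e. real (x e) - real (b e))"
          unfolding c'_def upd c(1)[symmetric] by simp
        have pos: "0 \<le> c' d \<and> (d \<in> snd p \<longrightarrow> 0 < c' d)" if "d \<in> fst p" for d
          using c(2) that False by (auto simp: c'_def split: if_splits)
        \<comment> \<open>This makes the natural subtraction \<open>x e - b e\<close> a true
          one.\<close>
        have "0 \<le> lincomb (fst p) c' e" for e
          unfolding lincomb_def using pos by (intro sum_nonneg mult_nonneg_nonneg) auto
        then have le: "b e \<le> x e" for e by (simp add: c')
        have "(\<lambda>e. real (x e - b e)) = lincomb (fst p) c'"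
          using le by (simp add: c' of_nat_diff)
        then have "(\<lambda>e. x e - b e) \<in> partial_cone p (insert b D)"
          unfolding partial_cone_def using pos c(3)
          by (intro CollectI exI[of _ c']) (auto simp: c'_def)
        moreover have "x = (\<lambda>e. (x e - b e) + b e)" using le by (simp add: fun_eq_iff)
        ultimately show ?thesis by (intro UnI2 image_eqI[of _ _ "\<lambda>e. x e - b e"])
      qed
    qed
    have "partial_cone p D \<subseteq> partial_cone p (insert b D)" unfolding partial_cone_def by blast
    then show "partial_cone p D \<union> (\<lambda>x e. x e + b e) ` partial_cone p (insert b D)
        \<subseteq> partial_cone p (insert b D)" using shift by auto
  qed
  show ?disj
  proof (rule ccontr)
    assume "\<not> ?disj"
    then obtain x where x: "x \<in> partial_cone p (insert b D)" "(\<lambda>e. x e + b e) \<in> partial_cone p D"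
      by auto
    then obtain c c' where c: "(\<lambda>e. real (x e)) = lincomb (fst p) c"
      "\<forall>b\<in>fst p. 0 \<le> c b \<and> (b \<in> snd p \<longrightarrow> 0 < c b)"
      and c': "(\<lambda>e. real (x e + b e)) = lincomb (fst p) c'"
      "\<forall>d\<in>fst p - D. if d \<in> snd p then c' d \<le> 1 else c' d < 1"
      by (auto simp: partial_cone_def)
    have "lincomb (fst p) c' = lincomb (fst p) (c(b := c b + 1))"
      unfolding upd c(1)[symmetric] c'(1)[symmetric] by simp
    from basis_coeffs_unique[OF B this b(1)] have "c' b = c b + 1" by simp
    moreover have "0 \<le> c b" "b \<in> snd p \<longrightarrow> 0 < c b" using c(2) b(1) by auto
    moreover have "if b \<in> snd p then c' b \<le> 1 else c' b < 1" using c'(2) b by blast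
    ultimately show False by (auto split: if_splits)
  qed
qed

lemma partial_cone_supported:
  assumes "fst p \<subseteq> supported E"
  shows "partial_cone p D \<subseteq> supported E"
proof -
  have "lincomb (fst p) c e = 0" if "e \<notin> E" for c e
    unfolding lincomb_def using assms that by (intro sum.neutral) (auto simp: supported_def)
  then show ?thesis
    unfolding partial_cone_def supported_def by (auto simp: fun_eq_iff) (metis of_nat_eq_0_iff)
qed

lemma finite_partial_cone:
  assumes "finite (fst p)" "fst p \<subseteq> supported E" "finite E"
  shows "finite (partial_cone p {})"
proof (rule finite_subset)
  define N where "N = (\<Sum>e\<in>E. \<Sum>b\<in>fst p. b e)"
  have "x e \<le> N" if x: "x \<in> partial_cone p {}" and e: "e \<in> E" for x e
  proof -
    obtain c where c: "(\<lambda>e. real (x e)) = lincomb (fst p) c"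
      "\<forall>b\<in>fst p. if b \<in> snd p then c b \<le> 1 else c b < 1"
      using x by (auto simp: partial_cone_def)
    have "real (x e) = (\<Sum>b\<in>fst p. c b * real (b e))" using c(1) by (simp add: fun_eq_iff lincomb_def)
    also have "\<dots> \<le> (\<Sum>b\<in>fst p. 1 * real (b e))"
      using c(2) by (intro sum_mono mult_right_mono) (auto split: if_splits intro: less_imp_le)
    also have "\<dots> = real (\<Sum>b\<in>fst p. b e)" by simp
    finally have "x e \<le> (\<Sum>b\<in>fst p. b e)" by linarith
    also have "\<dots> \<le> N"
      unfolding N_def using e assms(3) by (intro member_le_sum[of e E "\<lambda>e. \<Sum>b\<in>fst p. b e"]) auto
    finally show ?thesis .
  qed
  then show "partial_cone p {} \<subseteq> {x \<in> supported E. \<forall>e\<in>E. x e \<le> N}"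
    using partial_cone_supported[OF assms(2)] by blast
qed (rule finite_supported_bounded[OF assms(3)])

text \<open>Starting from the parallelepiped, the generators are released one at a time. By
  \<open>partial_cone_insert\<close> the series G after releasing \<open>b\<close> satisfies G = G'
  + q^|b| t G, where G' is the series before; each release thus costs one factor of the
  denominator.\<close>

lemma lattice_gf_half_open_cone:
  assumes B: "basis_of (fst p) U" and A: "finite A" and sup: "fst p \<subseteq> supported (insert z A)"
    and deg: "\<And>b. b \<in> fst p \<Longrightarrow> b z = 1"
  shows "lattice_gf z A {x. (\<lambda>e. real (x e)) \<in> half_open_cone p} *
      fps2_of_poly2 (\<Prod>b\<in>fst p. lin_factor (sum b A))
    = fps2_of_poly2 (\<Sum>x\<in>partial_cone p {}. monom (monom 1 (sum x A)) (x z))"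
proof -
  have fin: "finite (fst p)" using B by (simp add: basis_of_def)
  have "lattice_gf z A (partial_cone p D) * fps2_of_poly2 (\<Prod>b\<in>D. lin_factor (sum b A))
      = lattice_gf z A (partial_cone p {})" if "D \<subseteq> fst p" for D
    using finite_subset[OF that fin] that
  proof (induction D rule: finite_induct)
    case (insert b D)
    let ?G = "\<lambda>D. lattice_gf z A (partial_cone p D)"
    have b: "b \<in> fst p" using insert.prems by blast
    note ins = partial_cone_insert[OF B b insert.hyps(2)]
    note supp = partial_cone_supported[OF sup]
    have "?G (insert b D) = lattice_gf z A
        (partial_cone p D \<union> (\<lambda>x e. x e + b e) ` partial_cone p (insert b D))"
      using ins(1) by simp
    also have "\<dots> = ?G D + lattice_gf z A ((\<lambda>x e. x e + b e) ` partial_cone p (insert b D))"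
    proof (rule lattice_gf_Un[OF A supp _ ins(2)])
      show "(\<lambda>x e. x e + b e) ` partial_cone p (insert b D) \<subseteq> supported (insert z A)"
        using ins(1) supp[of "insert b D"] by blast
    qed
    also have "\<dots> = ?G D + fps_X * fps_const (fps_X ^ sum b A) * ?G (insert b D)"
      by (simp add: lattice_gf_shift deg[OF b])
    finally have "?G (insert b D) * fps2_of_poly2 (lin_factor (sum b A)) = ?G D"
      unfolding fps2_of_poly2_lin_factor by (simp add: algebra_simps)
    moreover have "(\<Prod>b\<in>insert b D. lin_factor (sum b A))
        = lin_factor (sum b A) * (\<Prod>b\<in>D. lin_factor (sum b A))"
      using insert.hyps by simp
    ultimately have "?G (insert b D) * fps2_of_poly2 (\<Prod>b\<in>insert b D. lin_factor (sum b A))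
      = ?G D * fps2_of_poly2 (\<Prod>b\<in>D. lin_factor (sum b A))"
      by (simp add: fps2_of_poly2_mult mult.assoc[symmetric])
    then show ?case using insert by simp
  qed simp
  from this[OF order_refl] show ?thesis
    using A by (simp add: partial_cone_full lattice_gf_finite finite_partial_cone[OF fin sup])
qed

lemma prod_mset_sum:
  "prod_mset (image_mset f (\<Sum>p\<in>C. g p)) = (\<Prod>p\<in>C. prod_mset (image_mset f (g p)))"
  by (induction C rule: infinite_finite_induct) simp_all

lemma cone_generating_function:
  fixes A :: "'e set" and W :: "('e \<Rightarrow> real) set" and H :: "('e \<Rightarrow> nat) set"
  assumes fin: "finite A"
    and supp: "\<And>x e. x \<in> W \<Longrightarrow> e \<notin> insert z A \<Longrightarrow> x e = 0"
    and zero: "(\<lambda>_. 0) \<in> W"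
    and lin: "\<And>x y c. x \<in> W \<Longrightarrow> y \<in> W \<Longrightarrow> (\<lambda>e. x e + c * y e) \<in> W"
    and HW: "\<And>g. g \<in> H \<Longrightarrow> (\<lambda>e. real (g e)) \<in> W" and Hz: "\<And>g. g \<in> H \<Longrightarrow> g z = 1"
    and gen: "\<And>x. x \<in> W \<Longrightarrow> (\<And>e. 0 \<le> x e) \<Longrightarrow> x \<noteq> (\<lambda>_. 0) \<Longrightarrow>
      \<exists>g\<in>H. (\<exists>e. g e \<noteq> 0) \<and> (\<forall>e. g e \<noteq> 0 \<longrightarrow> x e \<noteq> 0)"
  shows "\<exists>J P k h. lattice_gf z A {x. (\<lambda>e. real (x e)) \<in> W} *
        fps2_of_poly2 (\<Prod>j\<in>#J. lin_factor j) = fps2_of_poly2 P \<and>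
      eval_q1 P = [:1, - 1:] ^ k * h \<and> (\<forall>i. 0 \<le> coeff h i)"
proof -
  have "\<exists>C U. finite C \<and>
    (\<forall>p\<in>C. fst p \<subseteq> H \<and> snd p \<subseteq> fst p \<and> basis_of (fst p) U) \<and>
    {x \<in> W. \<forall>e. 0 \<le> x e} = (\<Union>p\<in>C. half_open_cone p) \<and>
    (\<forall>p\<in>C. \<forall>p'\<in>C. \<forall>x. x \<in> half_open_cone p \<longrightarrow> x \<in> half_open_cone p' \<longrightarrow> p = p')"
    (is "\<exists>C U. ?dec C U")
    by (rule nonneg_cone_decomposition[of "insert z A" W H])
      ((rule supp zero lin HW gen; assumption) | simp add: fin)+
  then obtain C U where CU_all: "?dec C U" by (elim exE)
  have C: "finite C" "\<forall>p\<in>C. fst p \<subseteq> H \<and> snd p \<subseteq> fst p \<and> basis_of (fst p) U"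
    and cover: "{x \<in> W. \<forall>e. 0 \<le> x e} = (\<Union>p\<in>C. half_open_cone p)"
    and disj: "\<forall>p\<in>C. \<forall>p'\<in>C. \<forall>x. x \<in> half_open_cone p \<longrightarrow> x \<in> half_open_cone p' \<longrightarrow> p = p'"
    by (rule CU_all[THEN conjunct1] CU_all[THEN conjunct2, THEN conjunct1]
        CU_all[THEN conjunct2, THEN conjunct2, THEN conjunct1]
        CU_all[THEN conjunct2, THEN conjunct2, THEN conjunct2])+
  have CH: "fst p \<subseteq> H" and CU: "basis_of (fst p) U" if "p \<in> C" for p using C(2) that by simp_all
  define M where "M = {x::'e \<Rightarrow> nat. (\<lambda>e. real (x e)) \<in> W}"
  define X where "X p = {x::'e \<Rightarrow> nat. (\<lambda>e. real (x e)) \<in> half_open_cone p}" for p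
  define N where "N p = (\<Sum>x\<in>partial_cone p {}. monom (monom 1 (sum x A)) (x z) :: int poly poly)" for p
  define D where "D p = (\<Prod>b\<in>fst p. lin_factor (sum b A))" for p :: "('e \<Rightarrow> nat) set \<times> ('e \<Rightarrow> nat) set"
  define J where "J = (\<Sum>p\<in>C. image_mset (\<lambda>b. sum b A) (mset_set (fst p)))"
  define P where "P = (\<Sum>p\<in>C. N p * (\<Prod>p'\<in>C - {p}. D p'))"
  have M_supp: "M \<subseteq> supported (insert z A)"
    unfolding M_def supported_def using supp by fastforce
  have H_supp: "H \<subseteq> supported (insert z A)" using HW M_supp by (auto simp: M_def)
  have M: "M = (\<Union>p\<in>C. X p)"
  proof -
    have "x \<in> M \<longleftrightarrow> (\<lambda>e. real (x e)) \<in> {x \<in> W. \<forall>e. 0 \<le> x e}" for x by (simp add: M_def)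
    then show ?thesis unfolding cover by (auto simp: X_def)
  qed
  have J: "(\<Prod>j\<in>#J. lin_factor j) = (\<Prod>p\<in>C. D p)"
    unfolding J_def prod_mset_sum D_def
    by (simp add: prod_unfold_prod_mset image_mset.compositionality comp_def)
  have cell: "lattice_gf z A (X p) * fps2_of_poly2 (D p) = fps2_of_poly2 (N p)" if "p \<in> C" for p
    unfolding X_def D_def N_def
    by (rule lattice_gf_half_open_cone[OF CU[OF that] fin]) (use CH[OF that] H_supp Hz in auto)
  have "lattice_gf z A M = (\<Sum>p\<in>C. lattice_gf z A (X p))"
    unfolding M
  proof (rule lattice_gf_UN[OF fin C(1)])
    show "X p \<subseteq> supported (insert z A)" if "p \<in> C" for p using M M_supp that by blast
    show "X p \<inter> X p' = {}" if "p \<in> C" "p' \<in> C" "p \<noteq> p'" for p p'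
      using disj that by (auto simp: X_def)
  qed
  then have "lattice_gf z A M * fps2_of_poly2 (\<Prod>j\<in>#J. lin_factor j)
      = (\<Sum>p\<in>C. lattice_gf z A (X p) * fps2_of_poly2 (\<Prod>p\<in>C. D p))"
    by (simp add: J sum_distrib_right)
  also have "\<dots> = (\<Sum>p\<in>C. fps2_of_poly2 (N p * (\<Prod>p'\<in>C - {p}. D p')))"
  proof (rule sum.cong[OF refl])
    fix p assume p: "p \<in> C"
    have "fps2_of_poly2 (\<Prod>p\<in>C. D p) = fps2_of_poly2 (D p) * fps2_of_poly2 (\<Prod>p'\<in>C - {p}. D p')"
      by (simp add: prod.remove[OF C(1) p] fps2_of_poly2_mult)
    then show "lattice_gf z A (X p) * fps2_of_poly2 (\<Prod>p\<in>C. D p)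
        = fps2_of_poly2 (N p * (\<Prod>p'\<in>C - {p}. D p'))"
      by (simp add: fps2_of_poly2_mult cell[OF p, symmetric] mult.assoc)
  qed
  also have "\<dots> = fps2_of_poly2 P" by (simp add: P_def fps2_of_poly2_sum)
  finally have rat: "lattice_gf z A M * fps2_of_poly2 (\<Prod>j\<in>#J. lin_factor j) = fps2_of_poly2 P" .
  \<comment> \<open>All cells are bases of the same space \<open>U\<close>. At q = 1 the common
    denominator therefore multiplies each numerator by the same power of 1 - t, contributed by the
    other \<open>card C - 1\<close> cells.\<close>
  obtain r where r: "\<And>p. p \<in> C \<Longrightarrow> card (fst p) = r"
    using basis_card_eq[OF CU CU] by metis
  define h where "h = (\<Sum>p\<in>C. eval_q1 (N p))"
  have "eval_q1 (N p * (\<Prod>p'\<in>C - {p}. D p')) = [:1, - 1:] ^ (r * (card C - 1)) * eval_q1 (N p)"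
    if p: "p \<in> C" for p
  proof -
    have "eval_q1 (D p') = [:1, - 1:] ^ r" if "p' \<in> C" for p'
      by (simp add: D_def eval_q1_prod eval_q1_lin_factor r[OF that])
    then have "eval_q1 (\<Prod>p'\<in>C - {p}. D p') = (\<Prod>p'\<in>C - {p}. [:1, - 1:] ^ r)"
      unfolding eval_q1_prod by (intro prod.cong) auto
    then show ?thesis
      using p C(1) by (simp add: eval_q1_mult card_Diff_singleton power_mult mult.commute)
  qed
  then have "eval_q1 P = [:1, - 1:] ^ (r * (card C - 1)) * h"
    by (simp add: P_def h_def eval_q1_sum sum_distrib_left)
  moreover have "0 \<le> coeff h i" for i
    unfolding h_def N_def coeff_sum coeff_eval_q1 poly_sum
    by (intro sum_nonneg) (simp add: poly_monom)
  ultimately show ?thesis using rat unfolding M_def by blast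
qed

text \<open>The constant term of \<open>F\<close> in t makes that of \<open>P\<close> equal to 1, so
  \<open>P\<close> does not vanish identically at q = 1. Hence \<open>h\<close> is nonzero and its
  coefficient sum \<open>poly h 1\<close> is positive. The \<open>c\<close> cancelled factors then
  satisfy \<open>c \<le> k\<close>, and after division the cofactor is still
  \<open>h\<close>.\<close>

lemma coprime_rational_form:
  assumes F: "F * fps2_of_poly2 (\<Prod>j\<in>#J0. lin_factor j) = fps2_of_poly2 P0"
    and ev: "eval_q1 P0 = [:1, - 1:] ^ k * h" and h: "\<And>i. 0 \<le> coeff h i"
    and F0: "fps_nth F 0 = 1"
  shows "\<exists>P Q. F * fps2_of_poly2 Q = fps2_of_poly2 P \<and> coprime P Q \<and> poly (poly P 0) 0 = 1 \<and>
    (\<exists>J. Q = (\<Prod>j\<in>#J. lin_factor j)) \<and>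
    (\<exists>s R. eval_q1 P = [:1, - 1:] ^ s * R \<and> poly R 1 \<noteq> 0 \<and> (\<forall>i. 0 \<le> coeff R i))"
proof -
  obtain J P where J: "P0 = P * (\<Prod>j\<in>#J0 - J. lin_factor j)"
    "J \<subseteq># J0" "coprime P (\<Prod>j\<in>#J. lin_factor j)"
    using cancel_lin_factors[of J0 P0] by blast
  let ?Q = "\<Prod>j\<in>#J. lin_factor j" and ?Q' = "\<Prod>j\<in>#J0 - J. lin_factor j"
  have nz: "?Q' \<noteq> 0" by (auto simp: lin_factor_def)
  have split: "(\<Prod>j\<in>#J0. lin_factor j) = ?Q * ?Q'"
    using J(2) by (metis image_mset_union prod_mset_Un subset_mset.add_diff_inverse)
  have "(F * fps2_of_poly2 ?Q) * fps2_of_poly2 ?Q' = fps2_of_poly2 P * fps2_of_poly2 ?Q'"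
    using F unfolding J(1) split fps2_of_poly2_mult by (simp add: mult.assoc)
  then have FP: "F * fps2_of_poly2 ?Q = fps2_of_poly2 P"
    using nz fps2_of_poly2_eq_0_iff by simp
  have Q0: "coeff (\<Prod>j\<in>#J. lin_factor j) 0 = 1"
    by (induction J) (simp_all add: coeff_mult lin_factor_def)
  have P0: "coeff P 0 = 1"
  proof (rule poly_eqI)
    fix d
    have "coeff (coeff P 0) d = fps_nth (fps_nth (F * fps2_of_poly2 ?Q) 0) d" unfolding FP by simp
    also have "\<dots> = coeff (coeff ?Q 0) d" by (simp add: F0)
    finally show "coeff (coeff P 0) d = coeff 1 d" by (simp add: Q0)
  qed
  define c where "c = size (J0 - J)"
  have evP: "[:1, - 1:] ^ c * eval_q1 P = [:1, - 1:] ^ k * h"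
    using ev by (simp add: J(1) c_def eval_q1_mult eval_q1_prod_mset eval_q1_lin_factor
        prod_mset_constant mult.commute)
  have "eval_q1 P \<noteq> 0"
  proof
    assume "eval_q1 P = 0"
    then have "coeff (eval_q1 P) 0 = 0" by simp
    then show False by (simp add: P0)
  qed
  then have "h \<noteq> 0" using evP by auto
  then have "0 < coeff h (degree h)" using h[of "degree h"] by (simp add: order_less_le)
  then have "0 < (\<Sum>i\<le>degree h. coeff h i)"
    using h by (intro sum_pos2[of _ "degree h"]) auto
  then have h1: "poly h 1 \<noteq> 0" by (simp add: poly_altdef)
  \<comment> \<open>Otherwise \<open>1 - t\<close> would divide \<open>h\<close>.\<close>
  have "c \<le> k"
  proof (rule ccontr)
    assume "\<not> c \<le> k"
    then have "c = k + Suc (c - k - 1)" by simp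
    then have "[:1, - 1:] ^ k * ([:1, - 1:] ^ Suc (c - k - 1) * eval_q1 P) = [:1, - 1:] ^ k * h"
      using evP by (metis mult.assoc power_add)
    then have h: "[:1, - 1:] ^ Suc (c - k - 1) * eval_q1 P = h" by simp
    have "poly ([:1, - 1:] ^ Suc (c - k - 1) * eval_q1 P) 1 = 0" by simp
    then have "poly h 1 = 0" unfolding h .
    then show False using h1 by simp
  qed
  then have "[:1, - 1:] ^ c * eval_q1 P = [:1, - 1:] ^ c * ([:1, - 1:] ^ (k - c) * h)"
    using evP by (simp add: mult.assoc[symmetric] power_add[symmetric])
  then have "eval_q1 P = [:1, - 1:] ^ (k - c) * h" by simp
  moreover have "poly (poly P 0) 0 = 1" by (simp add: poly_0_coeff_0 P0)
  ultimately show ?thesis using FP J(3) h1 h by blast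
qed

section \<open>The flow cone\<close>

text \<open>Pairing the conservation law with the potential that maps vertex i to i gives a
  vanishing sum in which each edge has the positive weight \<open>snd e - fst e\<close>.\<close>

lemma circulation_acyclic:
  fixes x :: "nat \<times> nat \<Rightarrow> real"
  assumes fin: "finite A" and lt: "\<And>e. e \<in> A \<Longrightarrow> fst e < snd e"
    and nonneg: "\<And>e. e \<in> A \<Longrightarrow> 0 \<le> x e"
    and net: "\<And>i. (\<Sum>e\<in>A. real_of_int (inc e i) * x e) = 0"
  shows "\<forall>e\<in>A. x e = 0"
proof -
  define W where "W = fst ` A \<union> snd ` A"
  have W: "finite W" using fin by (simp add: W_def)
  have inc: "(\<Sum>i\<in>W. real i * real_of_int (inc e i)) = real (fst e) - real (snd e)" if "e \<in> A" for e
  proof -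
    have "fst e \<in> W" "snd e \<in> W" using that by (auto simp: W_def)
    moreover have "real i * real_of_int (inc e i)
        = (if fst e = i then real i else 0) - (if snd e = i then real i else 0)" for i
      by (simp add: inc_def)
    ultimately show ?thesis using W by (simp add: sum_subtractf)
  qed
  have "0 = (\<Sum>i\<in>W. real i * (\<Sum>e\<in>A. real_of_int (inc e i) * x e))" by (simp add: net)
  also have "\<dots> = (\<Sum>e\<in>A. (\<Sum>i\<in>W. real i * real_of_int (inc e i)) * x e)"
    unfolding sum_distrib_left sum_distrib_right by (subst sum.swap) (simp add: mult.assoc)
  also have "\<dots> = (\<Sum>e\<in>A. - ((real (snd e) - real (fst e)) * x e))"
    by (rule sum.cong) (simp_all add: inc algebra_simps)
  finally have "(\<Sum>e\<in>A. (real (snd e) - real (fst e)) * x e) = 0" by (simp add: sum_negf)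
  moreover have "0 \<le> (real (snd e) - real (fst e)) * x e" if "e \<in> A" for e
    using lt[OF that] nonneg[OF that] by simp
  ultimately have "\<forall>e\<in>A. (real (snd e) - real (fst e)) * x e = 0"
    using fin by (simp add: sum_nonneg_eq_0_iff)
  moreover have "real (snd e) - real (fst e) \<noteq> 0" if "e \<in> A" for e using lt[OF that] by simp
  ultimately show ?thesis by (metis mult_eq_0_iff)
qed

section \<open>Flows as exponents in the product of geometric series\<close>

definition flow :: "(nat \<times> nat) set \<Rightarrow> (nat \<times> nat \<Rightarrow> nat) \<Rightarrow> nat \<Rightarrow>\<^sub>0 int" where
  "flow A f = (\<Sum>e\<in>A. Poly_Mapping.single (fst e) (int (f e)) - Poly_Mapping.single (snd e) (int (f e)))"

lemma lookup_flow: "Poly_Mapping.lookup (flow A f) i = (\<Sum>e\<in>A. inc e i * int (f e))"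
  unfolding flow_def lookup_sum
  by (rule sum.cong) (auto simp: lookup_minus lookup_single inc_def when_def)

lemma one_minus_mult_eq:
  fixes x :: "'a::comm_ring_1"
  assumes "y = z + x * y"
  shows "(1 - x) * y = z"
proof -
  have "(1 - x) * y = y - x * y" by (simp add: left_diff_distrib)
  also have "\<dots> = (z + x * y) - x * y" using assms by simp
  finally show ?thesis by simp
qed

text \<open>A function \<open>f\<close> records which power is taken from each geometric series. For
  a new edge \<open>e\<close>, either \<open>f e = 0\<close> or \<open>f\<close> arises from another
  function by raising its value at \<open>e\<close> by one; this gives a linear equation for the
  series of \<open>insert e A\<close>, which \<open>geom_inverse\<close> solves.\<close>

lemma prod_geom:
  assumes "finite A"
  shows "(\<Prod>(i, j)\<in>A. geom i j)
    = Abs_fps (\<lambda>d. \<Sum>f | f \<in> supported A \<and> sum f A = d. Poly_Mapping.single (flow A f) 1)"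
  using assms
proof (induction A rule: finite_induct)
  case empty
  have sup0: "supported {} = {\<lambda>_. 0}" by (auto simp: supported_def)
  have "{f. f \<in> supported {} \<and> sum f {} = d} = (if d = 0 then {\<lambda>_. 0} else {})" for d :: nat
    by (auto simp: supported_def)
  then show ?case by (intro fps_ext) (simp only: fps_nth_Abs_fps, simp add: flow_def sup0)
next
  case (insert e A)
  let ?S = "\<lambda>A d. {f. f \<in> supported A \<and> sum f A = d}"
  let ?F = "\<lambda>A. Abs_fps (\<lambda>d. \<Sum>f\<in>?S A d. Poly_Mapping.single (flow A f) (1::int))"
  have fin: "finite (?S B d)" if "finite B" for B d
    by (rule finite_subset[OF _ finite_supported_bounded[OF that, of d]])
      (use that member_le_sum in fastforce)
  define inc_e where "inc_e f = f(e := Suc (f e))" for f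
  have inj: "inj_on inc_e Z" for Z
  proof (rule inj_onI, rule ext)
    fix f g d assume "inc_e f = inc_e g"
    then show "f d = g d" unfolding inc_e_def by (cases "d = e") (metis fun_upd_same nat.inject,
          metis fun_upd_other)
  qed
  have sum_ins: "sum f (insert e A) = f e + sum f A" for f :: "nat \<times> nat \<Rightarrow> nat"
    using insert.hyps by simp
  have sum_A: "sum (inc_e f) A = sum f A" for f
    using insert.hyps by (intro sum.cong) (auto simp: inc_e_def)
  have S: "?S (insert e A) d = ?S A d \<union> (if d = 0 then {} else inc_e ` ?S (insert e A) (d - 1))" for d
  proof (rule set_eqI)
    fix f
    show "f \<in> ?S (insert e A) d \<longleftrightarrow>
      f \<in> ?S A d \<union> (if d = 0 then {} else inc_e ` ?S (insert e A) (d - 1))" (is "?l \<longleftrightarrow> ?r")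
    proof
      assume l: ?l
      show ?r
      proof (cases "f e")
        case 0
        then have "f x = 0" if "x \<notin> A" for x 
          using l that by (cases "x = e") (simp_all add: supported_def del: split_paired_All)
        then have "f \<in> supported A" by (simp add: supported_def)
        then show ?thesis using l 0 by (auto simp: sum_ins)
      next
        case (Suc k)
        have f: "f = inc_e (f(e := k))" using Suc by (simp add: inc_e_def fun_eq_iff)
        have "sum (f(e := k)) A = sum f A" using sum_A[of "f(e := k)"] f by simp
        then have "f(e := k) \<in> ?S (insert e A) (d - 1)" "d \<noteq> 0"
          using l Suc by (auto simp: supported_def sum_ins)
        then show ?thesis using f by auto
      qed
    next
      assume ?r
      then consider "f \<in> ?S A d" | g where "d \<noteq> 0" "f = inc_e g" "g \<in> ?S (insert e A) (d - 1)"
        by (auto split: if_splits)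
      then show ?l
      proof cases
        case 1
        then have "f e = 0" using insert.hyps(2) unfolding supported_def by blast
        then show ?thesis using 1 by (simp add: supported_def sum_ins)
      next
        case 2
        then have "sum f (insert e A) = d" by (simp add: sum_ins sum_A) (simp add: inc_e_def)
        then show ?thesis using 2 by (auto simp: supported_def inc_e_def)
      qed
    qed
  qed
  have flow_A: "flow (insert e A) f = flow A f" if "f \<in> supported A" for f
    using that insert.hyps by (simp add: flow_def supported_def del: split_paired_All)
  have flow_inc: "Poly_Mapping.single (flow (insert e A) (inc_e f)) 1
      = xratio (fst e) (snd e) * Poly_Mapping.single (flow (insert e A) f) (1::int)" for f
  proof -
    have "flow A (inc_e f) = flow A f"
      unfolding flow_def using insert.hyps by (intro sum.cong) (auto simp: inc_e_def)
    then have "flow (insert e A) (inc_e f)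
        = (Poly_Mapping.single (fst e) 1 - Poly_Mapping.single (snd e) 1) + flow (insert e A) f"
      using insert.hyps by (simp add: flow_def) (simp add: inc_e_def single_add algebra_simps)
    then show ?thesis by (simp add: xratio_def mult_single)
  qed
  have "?F (insert e A) = ?F A + fps_X * fps_const (xratio (fst e) (snd e)) * ?F (insert e A)"
  proof (rule fps_ext)
    fix d
    have "(\<Sum>f\<in>?S (insert e A) d. Poly_Mapping.single (flow (insert e A) f) (1::int))
      = (\<Sum>f\<in>?S A d. Poly_Mapping.single (flow (insert e A) f) 1)
      + (\<Sum>f\<in>(if d = 0 then {} else inc_e ` ?S (insert e A) (d - 1)).
          Poly_Mapping.single (flow (insert e A) f) 1)"
      unfolding S[of d]
    proof (rule sum.union_disjoint)
      show "finite (?S A d)" by (rule fin[OF insert.hyps(1)])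
      have "finite (inc_e ` ?S (insert e A) (d - 1))"
        using insert.hyps(1) by (intro finite_imageI fin) simp
      then show "finite (if d = 0 then {} else inc_e ` ?S (insert e A) (d - 1))"
        by (cases "d = 0") (simp_all only: if_True if_False finite.emptyI simp_thms)
      have "f \<notin> inc_e ` Z" if "f \<in> ?S A d" for f Z
      proof -
        have "f e = 0" using that insert.hyps(2) unfolding supported_def by blast
        then show ?thesis by (auto simp: inc_e_def)
      qed
      then show "?S A d \<inter> (if d = 0 then {} else inc_e ` ?S (insert e A) (d - 1)) = {}"
        by (cases "d = 0") (simp_all only: if_True if_False simp_thms Int_empty_right, blast)
    qed
    moreover have "(\<Sum>f\<in>?S A d. Poly_Mapping.single (flow (insert e A) f) (1::int))
        = (\<Sum>f\<in>?S A d. Poly_Mapping.single (flow A f) 1)"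
      by (rule sum.cong) (auto simp: flow_A)
    moreover have "(\<Sum>f\<in>(if d = 0 then {} else inc_e ` ?S (insert e A) (d - 1)).
          Poly_Mapping.single (flow (insert e A) f) (1::int))
        = (if d = 0 then 0 else xratio (fst e) (snd e) *
            (\<Sum>f\<in>?S (insert e A) (d - 1). Poly_Mapping.single (flow (insert e A) f) 1))"
      by (simp add: sum.reindex[OF inj] flow_inc sum_distrib_left)
    ultimately show "fps_nth (?F (insert e A)) d
      = fps_nth (?F A + fps_X * fps_const (xratio (fst e) (snd e)) * ?F (insert e A)) d"
      by (simp add: mult.assoc)
  qed
  then have F_A: "(1 - fps_X * fps_const (xratio (fst e) (snd e))) * ?F (insert e A) = ?F A"
    by (rule one_minus_mult_eq)
  have "geom (fst e) (snd e) * ?F A = ?F (insert e A)"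
    unfolding F_A[symmetric] mult.assoc[symmetric] mult.commute[of "geom (fst e) (snd e)"]
    by (simp only: geom_inverse mult_1)
  moreover have "(\<Prod>(i, j)\<in>insert e A. geom i j) = geom (fst e) (snd e) * (\<Prod>(i, j)\<in>A. geom i j)"
    using insert.hyps by (simp add: case_prod_beta)
  ultimately show ?case unfolding insert.IH by (rule trans[rotated])
qed

lemma K_nth:
  "fps_nth (K \<eta> \<gamma>) d = int (card {f \<in> supported (Phi \<eta>). sum f (Phi \<eta>) = d \<and> flow (Phi \<eta>) f = \<gamma>})"
proof -
  let ?S = "{f. f \<in> supported (Phi \<eta>) \<and> sum f (Phi \<eta>) = d}"
  have fin: "finite ?S"
    by (rule finite_subset[OF _ finite_supported_bounded[OF finite_Phi, of \<eta> d]])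
      (use member_le_sum[OF _ _ finite_Phi] in fastforce)
  have "fps_nth (K \<eta> \<gamma>) d = (\<Sum>f\<in>?S. 1 when flow (Phi \<eta>) f = \<gamma>)"
    by (simp add: K_def prod_geom[OF finite_Phi] lookup_sum lookup_single when_def eq_commute[of \<gamma>])
  also have "\<dots> = int (card {f \<in> ?S. flow (Phi \<eta>) f = \<gamma>})"
    unfolding card_filter_eq_sum[OF fin] by (simp add: when_def if_distrib[of int] cong: if_cong)
  also have "{f \<in> ?S. flow (Phi \<eta>) f = \<gamma>}
      = {f \<in> supported (Phi \<eta>). sum f (Phi \<eta>) = d \<and> flow (Phi \<eta>) f = \<gamma>}" by auto
  finally show ?thesis .
qed

lemma Phi_less: "e \<in> Phi \<eta> \<Longrightarrow> fst e < snd e"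
  by (auto simp: Phi_def)

lemma zero_notin_Phi: "(0, 0) \<notin> Phi \<eta>"
  by (auto simp: Phi_def)

(* No edge is (0, 0), so this coordinate is free to hold the multiple of \<gamma> that the flow realises. *)
definition flow_cone :: "(nat \<times> nat) set \<Rightarrow> (nat \<Rightarrow>\<^sub>0 int) \<Rightarrow> (nat \<times> nat \<Rightarrow> real) set" where
  "flow_cone A \<gamma> = {x. (\<forall>e. e \<notin> insert (0, 0) A \<longrightarrow> x e = 0) \<and>
    (\<forall>i. (\<Sum>e\<in>A. real_of_int (inc e i) * x e) = x (0, 0) * real_of_int (Poly_Mapping.lookup \<gamma> i))}"

lemma flow_cone_nat_iff:
  "(\<lambda>e. real (x e)) \<in> flow_cone A \<gamma> \<longleftrightarrow>
    x \<in> supported (insert (0, 0) A) \<and> flow A x = scale (x (0, 0)) \<gamma>"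
proof -
  have "(\<Sum>e\<in>A. real_of_int (inc e i) * real (x e)) = real (x (0, 0)) * real_of_int (Poly_Mapping.lookup \<gamma> i)
    \<longleftrightarrow> Poly_Mapping.lookup (flow A x) i = Poly_Mapping.lookup (scale (x (0, 0)) \<gamma>) i" for i
  proof -
    have "(\<Sum>e\<in>A. real_of_int (inc e i) * real (x e)) = real_of_int (\<Sum>e\<in>A. inc e i * int (x e))"
      by simp
    moreover have "real (x (0, 0)) * real_of_int (Poly_Mapping.lookup \<gamma> i)
        = real_of_int (int (x (0, 0)) * Poly_Mapping.lookup \<gamma> i)" by simp
    ultimately show ?thesis by (simp only: lookup_flow lookup_scale of_int_eq_iff)
  qed
  then show ?thesis
    by (auto simp: flow_cone_def supported_def poly_mapping_eq_iff fun_eq_iff)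
qed

lemma K_series_eq_lattice_gf:
  "Abs_fps (\<lambda>m. K \<eta> (scale m \<gamma>))
    = lattice_gf (0, 0) (Phi \<eta>) {x. (\<lambda>e. real (x e)) \<in> flow_cone (Phi \<eta>) \<gamma>}"
proof (intro fps_ext)
  fix m d
  let ?z = "(0::nat, 0::nat)" and ?A = "Phi \<eta>"
  have sum_upd: "sum (f(?z := k)) ?A = sum f ?A" for f :: "nat \<times> nat \<Rightarrow> nat" and k
    by (rule sum.cong) (use zero_notin_Phi[of \<eta>] in auto)
  have flow_upd: "flow ?A (f(?z := k)) = flow ?A f" for f k
    unfolding flow_def by (rule sum.cong) (use zero_notin_Phi[of \<eta>] in auto)
  \<comment> \<open>The multiplicity \<open>m\<close> is written into the free coordinate; the
    inverse map clears it. Neither changes the net flow or the total.\<close>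
  have "bij_betw (\<lambda>f. f(?z := m)) {f \<in> supported ?A. sum f ?A = d \<and> flow ?A f = scale m \<gamma>}
    {x \<in> {x. (\<lambda>e. real (x e)) \<in> flow_cone ?A \<gamma>}. x ?z = m \<and> sum x ?A = d}"
    by (rule bij_betwI[where g = "\<lambda>f. f(?z := 0)"])
      (use zero_notin_Phi[of \<eta>] in \<open>auto simp: flow_cone_nat_iff sum_upd[unfolded fun_upd_def] flow_upd supported_def fun_eq_iff\<close>)
  from bij_betw_same_card[OF this]
  show "fps_nth (fps_nth (Abs_fps (\<lambda>m. K \<eta> (scale m \<gamma>))) m) d
    = fps_nth (fps_nth (lattice_gf ?z ?A {x. (\<lambda>e. real (x e)) \<in> flow_cone ?A \<gamma>}) m) d"
    by (simp add: K_nth lattice_gf_def)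
qed

text \<open>By acyclicity only the zero flow has net flow 0. This is the constant term in t of the
  series, and the source of P(0,0) = 1.\<close>

lemma K_zero: "K \<eta> (scale 0 \<gamma>) = 1"
proof (rule fps_ext)
  fix d
  let ?A = "Phi \<eta>"
  have scale0: "scale 0 \<gamma> = 0" by (intro poly_mapping_eqI) (simp add: lookup_scale)
  have zero: "f = (\<lambda>_. 0)" if f: "f \<in> supported ?A" "flow ?A f = 0" for f
  proof -
    have "(\<Sum>e\<in>?A. real_of_int (inc e i) * real (f e)) = 0" for i
    proof -
      have "(\<Sum>e\<in>?A. real_of_int (inc e i) * real (f e)) = real_of_int (\<Sum>e\<in>?A. inc e i * int (f e))"
        by simp
      also have "\<dots> = 0" unfolding lookup_flow[symmetric] by (simp add: f(2))
      finally show ?thesis .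
    qed
    then have "\<forall>e\<in>?A. real (f e) = 0"
      by (intro circulation_acyclic finite_Phi Phi_less) auto
    then have in_A: "f e = 0" if "e \<in> ?A" for e using that by simp
    have "f e = 0" for e
    proof (cases "e \<in> ?A")
      case False
      then show ?thesis using f(1) unfolding supported_def by blast
    qed (rule in_A)
    then show ?thesis by (rule ext)
  qed
  have "f \<in> supported ?A \<and> sum f ?A = d \<and> flow ?A f = 0 \<longleftrightarrow> d = 0 \<and> f = (\<lambda>_. 0)" (is "?l f \<longleftrightarrow> ?r f") for f
  proof
    assume l: "?l f"
    then have "f = (\<lambda>_. 0)" by (intro zero) simp_all
    with l show "?r f" by simp
  next
    assume r: "?r f"
    then show "?l f" by (simp add: supported_def flow_def)
  qed
  then have "{f \<in> supported ?A. sum f ?A = d \<and> flow ?A f = scale 0 \<gamma>}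
      = (if d = 0 then {\<lambda>_. 0} else {})"
    unfolding scale0 by simp
  then show "fps_nth (K \<eta> (scale 0 \<gamma>)) d = fps_nth 1 d" by (simp add: K_nth fps_one_nth)
qed

text \<open>If \<open>x (0, 0)\<close> were 0, \<open>x\<close> would be a nonnegative circulation
  and so zero. Dividing by it gives a flow with the integral net flow \<gamma>, which is rounded
  inside its support; the coordinate (0,0) is then set to 1.\<close>

lemma flow_cone_generator:
  assumes fin: "finite A" and lt: "\<And>e. e \<in> A \<Longrightarrow> fst e < snd e" and z: "(0, 0) \<notin> A"
    and x: "x \<in> flow_cone A \<gamma>" "\<And>e. 0 \<le> x e" "x \<noteq> (\<lambda>_. 0)"
  shows "\<exists>g :: nat \<times> nat \<Rightarrow> nat. (\<lambda>e. real (g e)) \<in> flow_cone A \<gamma> \<and> g (0, 0) = 1 \<and>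
    (\<forall>e. g e \<noteq> 0 \<longrightarrow> x e \<noteq> 0)"
proof -
  let ?z = "(0::nat, 0::nat)"
  have net: "(\<Sum>e\<in>A. real_of_int (inc e i) * x e) = x ?z * real_of_int (Poly_Mapping.lookup \<gamma> i)" for i
    using x(1) by (simp add: flow_cone_def)
  have xz: "x ?z \<noteq> 0"
  proof
    assume 0: "x ?z = 0"
    then have "\<forall>e\<in>A. x e = 0" using net x(2) by (intro circulation_acyclic fin lt) auto
    moreover have "x e = 0" if "e \<notin> insert ?z A" for e
      using x(1) that unfolding flow_cone_def mem_Collect_eq by blast
    ultimately have "x e = 0" for e using 0 by (cases "e \<in> insert ?z A") auto
    then show False using x(3) by auto
  qed
  have net': "(\<Sum>e\<in>A. real_of_int (inc e i) * (x e / x ?z)) = real_of_int (Poly_Mapping.lookup \<gamma> i)" for i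
    using net[of i] xz by (simp add: sum_divide_distrib[symmetric])
  have "\<exists>g :: nat \<times> nat \<Rightarrow> nat. (\<forall>e. g e \<noteq> 0 \<longrightarrow> e \<in> A \<and> x e / x ?z \<noteq> 0) \<and>
    (\<forall>i. (\<Sum>e\<in>A. real_of_int (inc e i) * real (g e))
      = (\<Sum>e\<in>A. real_of_int (inc e i) * (x e / x ?z)))"
  proof (rule flow_rounding[OF fin])
    show "fst e \<noteq> snd e" if "e \<in> A" for e using lt[OF that] by simp
    show "(\<Sum>e\<in>A. real_of_int (inc e i) * (x e / x ?z)) \<in> \<int>" for i unfolding net' by simp
  qed (simp add: x(2))
  then obtain g :: "nat \<times> nat \<Rightarrow> nat" where g: "\<And>e. g e \<noteq> 0 \<Longrightarrow> e \<in> A \<and> x e / x ?z \<noteq> 0"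
    "\<And>i. (\<Sum>e\<in>A. real_of_int (inc e i) * real (g e)) = real_of_int (Poly_Mapping.lookup \<gamma> i)"
    unfolding net' by blast
  let ?g = "g(?z := 1)"
  have "(\<Sum>e\<in>A. real_of_int (inc e i) * real (?g e)) = (\<Sum>e\<in>A. real_of_int (inc e i) * real (g e))" for i
    by (rule sum.cong) (use z in auto)
  then have "(\<lambda>e. real (?g e)) \<in> flow_cone A \<gamma>"
    using g unfolding flow_cone_def by auto
  moreover have "x e \<noteq> 0" if "?g e \<noteq> 0" for e
    using that g(1)[of e] xz by (cases "e = ?z") auto
  ultimately show ?thesis by (intro exI[of _ ?g]) auto
qed

theorem theorem3p17:
  fixes n :: nat and \<eta> :: "nat list" and \<gamma> :: "nat \<Rightarrow>\<^sub>0 int"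
  assumes "\<forall>a\<in>set \<eta>. 0 < a"
    and "sum_list \<eta> = n"
    and "\<gamma> \<in> Y \<eta>"
  shows "\<exists>(P :: int poly poly) (Q :: int poly poly).
           Abs_fps (\<lambda>m. K \<eta> (scale m \<gamma>)) * fps2_of_poly2 Q = fps2_of_poly2 P
         \<and> coprime P Q
         \<and> poly (poly P 0) 0 = 1
         \<and> (\<exists>J :: nat multiset. Q = (\<Prod>j\<in>#J. [:1, - monom 1 j:]))
         \<and> (\<exists>(s :: nat) (R :: int poly).
               eval_q1 P = [:1, - 1:] ^ s * R
             \<and> poly R 1 \<noteq> 0
             \<and> (\<forall>i. 0 \<le> coeff R i))"
proof -
  let ?A = "Phi \<eta>" and ?W = "flow_cone (Phi \<eta>) \<gamma>"
  \<comment> \<open>The lattice points of degree 1, that is, the integral flows with net flow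
    \<gamma>.\<close>
  define H where "H = {g :: nat \<times> nat \<Rightarrow> nat. (\<lambda>e. real (g e)) \<in> ?W \<and> g (0, 0) = 1}"
  have "\<exists>J P k h. lattice_gf (0, 0) ?A {x. (\<lambda>e. real (x e)) \<in> ?W} *
        fps2_of_poly2 (\<Prod>j\<in>#J. lin_factor j) = fps2_of_poly2 P \<and>
      eval_q1 P = [:1, - 1:] ^ k * h \<and> (\<forall>i. 0 \<le> coeff h i)"
  proof (rule cone_generating_function[where H = H])
    show "(\<lambda>e. x e + c * y e) \<in> ?W" if "x \<in> ?W" "y \<in> ?W" for x y c
    proof -
      have "(\<Sum>e\<in>?A. real_of_int (inc e i) * (x e + c * y e))
          = (\<Sum>e\<in>?A. real_of_int (inc e i) * x e) + c * (\<Sum>e\<in>?A. real_of_int (inc e i) * y e)" for i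
        by (simp add: algebra_simps sum.distrib sum_distrib_left)
      then show ?thesis using that by (auto simp: flow_cone_def algebra_simps)
    qed
    show "\<exists>g\<in>H. (\<exists>e. g e \<noteq> 0) \<and> (\<forall>e. g e \<noteq> 0 \<longrightarrow> x e \<noteq> 0)"
      if x: "x \<in> ?W" "\<And>e. 0 \<le> x e" "x \<noteq> (\<lambda>_. 0)" for x
    proof -
      obtain g :: "nat \<times> nat \<Rightarrow> nat" where g: "(\<lambda>e. real (g e)) \<in> ?W" "g (0, 0) = 1"
        "\<forall>e. g e \<noteq> 0 \<longrightarrow> x e \<noteq> 0"
        using flow_cone_generator[OF finite_Phi Phi_less[of _ \<eta>] zero_notin_Phi x] by blast
      have "g (0, 0) \<noteq> 0" using g(2) by simp
      then show ?thesis using g unfolding H_def by blast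
    qed
  qed (auto simp: finite_Phi H_def flow_cone_def)
  then obtain J P k h where *: "Abs_fps (\<lambda>m. K \<eta> (scale m \<gamma>)) *
        fps2_of_poly2 (\<Prod>j\<in>#J. lin_factor j) = fps2_of_poly2 P"
      "eval_q1 P = [:1, - 1:] ^ k * h" "\<And>i. 0 \<le> coeff h i"
    unfolding K_series_eq_lattice_gf by blast
  have "fps_nth (Abs_fps (\<lambda>m. K \<eta> (scale m \<gamma>))) 0 = 1" by (simp add: K_zero)
  from coprime_rational_form[OF * this] show ?thesis unfolding lin_factor_def .
qed

end
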